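(* Let $d\in\mathbb{N}$ and $\sigma\in(0,\min\{1,d/2\})$. Let $V:\mathbb{Z}^d\to\mathbb{R}$ with $V\le1$ be such that the fractional Schrödinger operator $\Delta^\sigma+V$ is positive. Let $u:\mathbb{Z}^d\to\mathbb{R}$ be harmonic for $\Delta^\sigma+V$. If $u(x)=O(|x|^{\sigma-d/2})$ as $|x|\to\infty$ and $\liminf_{|x|\to\infty}|u(x)|\,|x|^{d+2\sigma}=0$, then $u=0$.
   Context: For $f:\mathbb{Z}^d\to\mathbb{R}$ let $\Delta f(x)=\sum_{y:|y-x|=1}(f(x)-f(y))$ ($|\cdot|$ Euclidean norm), with heat semigroup $e^{-t\Delta}$ on $\ell^2(\mathbb{Z}^d)$; $1_0$ is the indicator of $\{0\}$. For $\sigma\in(0,1)$ the Riesz kernel is $\kappa_\sigma(0)=0$ and $\kappa_\sigma(x)=\frac{1}{|\Gamma(-\sigma)|}\int_0^\infty e^{-t\Delta}1_0(x)\,\frac{dt}{t^{1+\sigma}}$ for $x\ne0$. The fractional Laplacian acts on functions $f$ with $\sum_y\kappa_\sigma(x-y)|f(y)|<\infty$ for all $x$ by $\Delta^\sigma f(x)=\sum_y\kappa_\sigma(x-y)(f(x)-f(y))$ (on $\ell^2$ this coincides with the spectral-theoretic power of $\Delta$). The operator $\Delta^\sigma+V$ is called positive if its quadratic form on $\ell^2(\mathbb{Z}^d)$ is nonnegative, i.e. $\langle\Delta^\sigma\varphi,\varphi\rangle+\sum_xV(x)\varphi(x)^2\ge0$ for all finitely supported $\varphi$. A function $u$ is harmonic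 for $\Delta^\sigma+V$ if $\Delta^\sigma u$ is defined and $\Delta^\sigma u(x)+V(x)u(x)=0$ for all $x\in\mathbb{Z}^d$. *)

theory Defs
  imports "HOL-Analysis.Analysis" "HOL-Library.Landau_Symbols"
begin

definition lnorm :: "int ^ 'd \<Rightarrow> real" where
  "lnorm x = sqrt (\<Sum>i\<in>UNIV. (real_of_int (x $ i))\<^sup>2)"

definition lat_infty :: "(int ^ 'd) filter" where
  "lat_infty = filtercomap lnorm at_top"

definition dlap :: "(int ^ 'd \<Rightarrow> real) \<Rightarrow> int ^ 'd \<Rightarrow> real" where
  "dlap f x = (\<Sum>y\<in>{y. lnorm (y - x) = 1}. f x - f y)"

text \<open>Heat semigroup e^{-t Delta} f, given by the exponential series of the
  bounded operator Delta.\<close>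
definition heat :: "real \<Rightarrow> (int ^ 'd \<Rightarrow> real) \<Rightarrow> int ^ 'd \<Rightarrow> real" where
  "heat t f x = (\<Sum>n. (-t) ^ n / fact n * (dlap ^^ n) f x)"

definition ind0 :: "int ^ 'd \<Rightarrow> real" where
  "ind0 x = (if x = 0 then 1 else 0)"

definition kappa :: "real \<Rightarrow> int ^ 'd \<Rightarrow> real" where
  "kappa \<sigma> x = (if x = 0 then 0 else
      1 / \<bar>Gamma (- \<sigma>)\<bar> * (LBINT t:{0<..}. heat t ind0 x * t powr (-(1 + \<sigma>))))"

definition frac_dom :: "real \<Rightarrow> (int ^ 'd \<Rightarrow> real) \<Rightarrow> bool" where
  "frac_dom \<sigma> f \<longleftrightarrow> (\<forall>x. (\<lambda>y. kappa \<sigma> (x - y) * \<bar>f y\<bar>) summable_on UNIV)"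

definition frac_lap :: "real \<Rightarrow> (int ^ 'd \<Rightarrow> real) \<Rightarrow> int ^ 'd \<Rightarrow> real" where
  "frac_lap \<sigma> f x = (\<Sum>\<^sub>\<infinity>y. kappa \<sigma> (x - y) * (f x - f y))"

definition frac_schr_positive :: "real \<Rightarrow> (int ^ 'd \<Rightarrow> real) \<Rightarrow> bool" where
  "frac_schr_positive \<sigma> V \<longleftrightarrow>
     (\<forall>\<phi> :: int ^ 'd \<Rightarrow> real. finite {x. \<phi> x \<noteq> 0} \<longrightarrow>
        (\<Sum>x\<in>{x. \<phi> x \<noteq> 0}. frac_lap \<sigma> \<phi> x * \<phi> x)
        + (\<Sum>x\<in>{x. \<phi> x \<noteq> 0}. V x * (\<phi> x)\<^sup>2) \<ge> 0)"

definition frac_harmonic :: "real \<Rightarrow> (int ^ 'd \<Rightarrow> real) \<Rightarrow> (int ^ 'd \<Rightarrow> real) \<Rightarrow> bool" where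
  "frac_harmonic \<sigma> V u \<longleftrightarrow> frac_dom \<sigma> u \<and> (\<forall>x. frac_lap \<sigma> u x + V x * u x = 0)"

end

theory Submission
  imports Defs
begin

text \<open>
  Testing positivity with \<open>\<bar>u\<bar> e\<close> for a finitely supported cutoff \<open>e\<close> and using that \<open>u\<close> is harmonic
  gives (with the kernel \<open>\<kappa>\<close>)
  \<open>\<Sum> \<kappa>(x - y) (\<bar>u(x) u(y)\<bar> - u(x) u(y)) e(x) e(y) \<le> \<Sum> \<kappa>(x - y) \<bar>u(x) u(y)\<bar> (e(x) - e(y))\<^sup>2\<close>.
  The decay \<open>u = O(\<bar>x\<bar> powr (\<sigma> - d/2))\<close> is exactly what makes the right-hand side bounded uniformly in \<open>R\<close>
  for the Lipschitz cutoff at scale \<open>R\<close>; convex combinations of cutoffs at very different scales make it arbitrarily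
  small. As \<open>\<kappa> > 0\<close> off the origin, \<open>u\<close> has constant sign. Then \<open>V \<le> 1\<close> and the equation give
  \<open>(1 + \<Sum>\<kappa>) \<bar>u(x)\<bar> \<ge> \<kappa>(x - y) \<bar>u(y)\<bar>\<close>, and \<open>\<kappa>(x) \<ge> c \<bar>x\<bar> powr (-d - 2\<sigma>)\<close> contradicts the limit inferior
  unless \<open>u = 0\<close>. About \<open>\<kappa>\<close> only that lower bound and
  \<open>\<Sum> \<kappa>(z) min(1, \<bar>z\<bar>\<^sup>2/R\<^sup>2) \<le> C R powr (-2\<sigma>)\<close> are needed; the latter follows from the mass and the second
  moment of the heat kernel.
\<close>

subsection \<open>The heat kernel on the lattice\<close>

text \<open>The value 0 at negative integers, as for 1/Gamma(z + 1), makes \<open>ifact_rec\<close>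
  true for every integer, so the recursion for \<open>bcoeff\<close> has no boundary cases.\<close>

definition ifact :: "int \<Rightarrow> real" where
  "ifact z = (if z < 0 then 0 else inverse (fact (nat z)))"

lemma ifact_nonneg: "ifact z \<ge> 0"
  by (simp add: ifact_def)

lemma ifact_rec: "of_int z * ifact z = ifact (z - 1)"
proof (cases "z > 0")
  case True
  then have "nat z = Suc (nat (z - 1))" by simp
  then have "fact (nat z) = real_of_int z * fact (nat (z - 1))"
    using True by (simp add: fact_Suc del: of_nat_Suc)
  then show ?thesis using True by (simp add: ifact_def)
qed (auto simp: ifact_def)

text \<open>The coefficient of \<open>t ^ m\<close> in the modified Bessel function \<open>I\<^sub>n(2t)\<close>; the heat kernel on the
  integers is \<open>exp (-2t) I\<^sub>n(2t)\<close>.\<close>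
definition bcoeff :: "nat \<Rightarrow> int \<Rightarrow> real" where
  "bcoeff m n = (if even (int m + n)
     then ifact ((int m + n) div 2) * ifact ((int m - n) div 2) else 0)"

lemma bcoeff_nonneg: "bcoeff m n \<ge> 0"
  by (simp add: bcoeff_def ifact_nonneg)

lemma bcoeff_minus: "bcoeff m (- n) = bcoeff m n"
  by (simp add: bcoeff_def mult.commute)

lemma bcoeff_0: "bcoeff 0 n = (if n = 0 then 1 else 0)"
  by (auto simp: bcoeff_def ifact_def elim!: evenE)

text \<open>With i and j half the sum and half the difference of \<open>Suc m\<close> and n, one has
  \<open>Suc m\<close> = i + j, and multiplying a reciprocal factorial by its index lowers that
  index. In generating functions this is the derivative rule for I_n(2t).\<close>

lemma bcoeff_Suc: "real (Suc m) * bcoeff (Suc m) n = bcoeff m (n - 1) + bcoeff m (n + 1)"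
proof (cases "even (int (Suc m) + n)")
  case True
  then obtain i where i: "int (Suc m) + n = 2 * i" by (elim evenE)
  define j where "j = int (Suc m) - i"
  have j: "int (Suc m) - n = 2 * j" using i by (simp add: j_def)
  have r: "real (Suc m) = of_int i + of_int j" by (simp add: j_def)
  have 1: "int m + (n - 1) = 2 * (i - 1)" "int m - (n - 1) = 2 * j"
    "int m + (n + 1) = 2 * i" "int m - (n + 1) = 2 * (j - 1)" using i j by auto
  have "bcoeff (Suc m) n = ifact i * ifact j"
    unfolding bcoeff_def i j by simp
  moreover have "bcoeff m (n - 1) = ifact (i - 1) * ifact j"
    unfolding bcoeff_def 1 by simp
  moreover have "bcoeff m (n + 1) = ifact i * ifact (j - 1)"
    unfolding bcoeff_def 1 by simp
  ultimately show ?thesis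
    unfolding r by (simp add: ifact_rec[symmetric] algebra_simps)
next
  case False
  then have "odd (int m + (n - 1))" "odd (int m + (n + 1))" by auto
  with False show ?thesis by (simp add: bcoeff_def)
qed

text \<open>Up to the factor \<open>fact m\<close>, \<open>bcoeff m n\<close> counts the walks of m
  unit steps from 0 to n, and there are 2^m walks in all. The set \<open>S\<close> is generalised
  because the recursion shifts it by one in both directions.\<close>

lemma sum_bcoeff_le: "finite S \<Longrightarrow> (\<Sum>n\<in>S. bcoeff m n) \<le> 2 ^ m / fact m"
proof (induction m arbitrary: S)
  case 0
  then show ?case by (simp add: bcoeff_0)
next
  case (Suc m)
  have "real (Suc m) * (\<Sum>n\<in>S. bcoeff (Suc m) n)
      = (\<Sum>n\<in>S. bcoeff m (n - 1)) + (\<Sum>n\<in>S. bcoeff m (n + 1))"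
    by (simp add: sum_distrib_left bcoeff_Suc sum.distrib del: of_nat_Suc)
  also have "(\<Sum>n\<in>S. bcoeff m (n - 1)) = (\<Sum>n\<in>(\<lambda>n. n - 1) ` S. bcoeff m n)"
    by (subst sum.reindex) (auto simp: inj_on_def)
  also have "(\<Sum>n\<in>S. bcoeff m (n + 1)) = (\<Sum>n\<in>(\<lambda>n. n + 1) ` S. bcoeff m n)"
    by (subst sum.reindex) (auto simp: inj_on_def)
  also have "(\<Sum>n\<in>(\<lambda>n. n - 1) ` S. bcoeff m n) + \<dots> \<le> 2 ^ m / fact m + 2 ^ m / fact m"
    using Suc by (intro add_mono) auto
  also have "\<dots> = real (Suc m) * (2 ^ Suc m / fact (Suc m))"
    by (simp add: field_simps del: of_nat_Suc)
  finally show ?case by (simp only: mult_le_cancel_left_pos of_nat_0_less_iff zero_less_Suc)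
qed

text \<open>The second moment of the simple walk grows by one per step, since (n + 1)^2 + (n - 1)^2
  = 2 n^2 + 2. The set \<open>T\<close> contains both shifts of \<open>S\<close>, so that this
  identity can be used termwise.\<close>

lemma sum_sq_bcoeff_le:
  "finite S \<Longrightarrow> (\<Sum>n\<in>S. (of_int n)\<^sup>2 * bcoeff m n) \<le> real m * 2 ^ m / fact m"
proof (induction m arbitrary: S)
  case 0
  have "(\<Sum>n\<in>S. (of_int n)\<^sup>2 * bcoeff 0 n) = (\<Sum>n\<in>S. 0)"
    by (intro sum.cong) (auto simp: bcoeff_0)
  then show ?case by simp
next
  case (Suc m)
  define T where "T = (\<lambda>n. n - 1) ` S \<union> (\<lambda>n. n + 1) ` S"
  have fT: "finite T" using Suc by (simp add: T_def)
  have "real (Suc m) * (\<Sum>n\<in>S. (of_int n)\<^sup>2 * bcoeff (Suc m) n)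
      = (\<Sum>n\<in>S. (of_int n)\<^sup>2 * (real (Suc m) * bcoeff (Suc m) n))"
    by (simp add: sum_distrib_left mult_ac)
  also have "\<dots> = (\<Sum>n\<in>S. (of_int n)\<^sup>2 * bcoeff m (n - 1)) + (\<Sum>n\<in>S. (of_int n)\<^sup>2 * bcoeff m (n + 1))"
    by (simp only: bcoeff_Suc sum.distrib ring_distribs)
  also have "(\<Sum>n\<in>S. (of_int n)\<^sup>2 * bcoeff m (n - 1))
      = (\<Sum>n\<in>(\<lambda>n. n - 1) ` S. (of_int n + 1)\<^sup>2 * bcoeff m n)"
    by (subst sum.reindex) (auto simp: inj_on_def)
  also have "\<dots> \<le> (\<Sum>n\<in>T. (of_int n + 1)\<^sup>2 * bcoeff m n)"
    using fT by (intro sum_mono2) (auto simp: T_def bcoeff_nonneg)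
  also have "(\<Sum>n\<in>S. (of_int n)\<^sup>2 * bcoeff m (n + 1))
      = (\<Sum>n\<in>(\<lambda>n. n + 1) ` S. (of_int n - 1)\<^sup>2 * bcoeff m n)"
    by (subst sum.reindex) (auto simp: inj_on_def)
  also have "\<dots> \<le> (\<Sum>n\<in>T. (of_int n - 1)\<^sup>2 * bcoeff m n)"
    using fT by (intro sum_mono2) (auto simp: T_def bcoeff_nonneg)
  also have "(\<Sum>n\<in>T. (of_int n + 1)\<^sup>2 * bcoeff m n) + \<dots>
      = 2 * (\<Sum>n\<in>T. (of_int n)\<^sup>2 * bcoeff m n) + 2 * (\<Sum>n\<in>T. bcoeff m n)"
    by (simp add: sum_distrib_left sum.distrib[symmetric] power2_eq_square algebra_simps)
  also have "\<dots> \<le> 2 * (real m * 2 ^ m / fact m) + 2 * (2 ^ m / fact m)"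
    using Suc.IH[OF fT] sum_bcoeff_le[OF fT, of m] by simp
  also have "\<dots> = 2 * real (Suc m) * 2 ^ m / fact m"
    by (simp add: algebra_simps add_divide_distrib)
  also have "\<dots> = real (Suc m) * (real (Suc m) * 2 ^ Suc m / fact (Suc m))"
    by (simp add: field_simps del: of_nat_Suc)
  finally show ?case by (simp only: mult_le_cancel_left_pos of_nat_0_less_iff zero_less_Suc)
qed

lemma bcoeff_le: "bcoeff m n \<le> 2 ^ m / fact m"
  using sum_bcoeff_le[of "{n}" m] by simp

section \<open>The heat kernel on the integers: power series, mass and second moment\<close>

definition heat_fps :: "int \<Rightarrow> real fps" where
  "heat_fps n = fps_exp (-2) * Abs_fps (\<lambda>m. bcoeff m n)"

text \<open>This is the heat equation on the integers: the exponential factor contributes -2, the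
  Bessel factor its two neighbours by \<open>bcoeff_Suc\<close>.\<close>

lemma fps_deriv_heat_fps:
  "fps_deriv (heat_fps n) = heat_fps (n - 1) + heat_fps (n + 1) - 2 * heat_fps n"
proof -
  have "fps_deriv (Abs_fps (\<lambda>m. bcoeff m n)) = Abs_fps (\<lambda>m. bcoeff m (n - 1)) + Abs_fps (\<lambda>m. bcoeff m (n + 1))"
    by (rule fps_ext) (simp add: bcoeff_Suc[symmetric])
  moreover have "fps_deriv (fps_exp (- 2 :: real)) = - (2 * fps_exp (- 2))"
    by (simp add: numeral_fps_const flip: fps_const_neg)
  ultimately show ?thesis by (simp add: heat_fps_def algebra_simps del: fps_exp_deriv)
qed

lemma bcoeff_conv_radius: "fps_conv_radius (Abs_fps (\<lambda>m. bcoeff m n)) = \<infinity>"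
proof -
  have "summable (\<lambda>m. bcoeff m n * z ^ m)" for z :: real
  proof (rule summable_comparison_test')
    show "summable (\<lambda>m. inverse (fact m) * (2 * \<bar>z\<bar>) ^ m)"
      using summable_exp[of "2 * \<bar>z\<bar>"] by (simp add: mult.commute)
    show "norm (bcoeff m n * z ^ m) \<le> inverse (fact m) * (2 * \<bar>z\<bar>) ^ m" for m
      using mult_right_mono[OF bcoeff_le[of m n], of "\<bar>z\<bar> ^ m"]
      by (simp add: abs_mult power_abs bcoeff_nonneg power_mult_distrib field_simps)
  qed
  then show ?thesis
    unfolding fps_conv_radius_def by (intro conv_radius_inftyI'') simp
qed

lemma heat_fps_conv_radius: "fps_conv_radius (heat_fps n) = \<infinity>"
  using fps_conv_radius_mult[of "fps_exp (-2)" "Abs_fps (\<lambda>m. bcoeff m n)"]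
  by (simp add: heat_fps_def bcoeff_conv_radius)

definition heat1 :: "real \<Rightarrow> int \<Rightarrow> real" where
  "heat1 t n = eval_fps (heat_fps n) t"

lemma bcoeff_summable: "summable (\<lambda>m. bcoeff m n * t ^ m)" for t :: real
  using summable_fps[of t "Abs_fps (\<lambda>m. bcoeff m n)"] by (simp add: bcoeff_conv_radius)

lemma heat1_eq: "heat1 t n = exp (-2 * t) * (\<Sum>m. bcoeff m n * t ^ m)"
  unfolding heat1_def heat_fps_def
  by (subst eval_fps_mult) (auto simp: bcoeff_conv_radius eval_fps_def[of "Abs_fps _"])

lemma heat1_minus: "heat1 t (- n) = heat1 t n"
  by (simp add: heat1_eq bcoeff_minus)

lemma heat1_nonneg: "t \<ge> 0 \<Longrightarrow> heat1 t n \<ge> 0"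
  by (auto simp: heat1_eq intro!: suminf_nonneg bcoeff_summable mult_nonneg_nonneg bcoeff_nonneg)

lemma continuous_on_heat1: "continuous_on A (\<lambda>t. heat1 t n)"
  unfolding heat1_def by (intro continuous_intros) (auto simp: heat_fps_conv_radius)

text \<open>Summing over n before m bounds the series by that of exp(2t), which cancels the
  prefactor.\<close>

lemma sum_heat1_le:
  assumes "t \<ge> 0" "finite S"
  shows "(\<Sum>n\<in>S. heat1 t n) \<le> 1"
proof -
  have "(\<Sum>n\<in>S. heat1 t n) = exp (-2*t) * (\<Sum>m. \<Sum>n\<in>S. bcoeff m n * t ^ m)"
    by (subst suminf_sum) (auto simp: heat1_eq sum_distrib_left bcoeff_summable)
  also have "(\<Sum>m. \<Sum>n\<in>S. bcoeff m n * t ^ m) \<le> (\<Sum>m. (2*t) ^ m /\<^sub>R fact m)"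
  proof (intro suminf_le summable_exp_generic summable_sum bcoeff_summable)
    fix m
    show "(\<Sum>n\<in>S. bcoeff m n * t ^ m) \<le> (2*t) ^ m /\<^sub>R fact m"
    proof -
      have "(\<Sum>n\<in>S. bcoeff m n * t ^ m) \<le> (2 ^ m / fact m) * t ^ m"
        unfolding sum_distrib_right[symmetric]
        using assms by (intro mult_right_mono sum_bcoeff_le) auto
      also have "\<dots> = (2*t) ^ m /\<^sub>R fact m"
        by (simp add: power_mult_distrib divide_inverse)
      finally show ?thesis .
    qed
  qed
  also have "\<dots> = exp (2*t)" by (simp add: exp_def)
  finally show ?thesis by (simp add: exp_minus field_simps)
qed

lemma sum_sq_heat1_le:
  assumes "t \<ge> 0" "finite S"
  shows "(\<Sum>n\<in>S. (of_int n)\<^sup>2 * heat1 t n) \<le> 2 * t"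
proof -
  \<comment> \<open>Shifted exponential series: \<open>Suc m\<close> times the term of index
    \<open>Suc m\<close> is 2t times the term of index m, and the term of index 0 vanishes.\<close>
  have *: "(\<lambda>m. real m * ((2*t) ^ m /\<^sub>R fact m)) sums (2 * t * exp (2*t))"
  proof -
    have "(\<lambda>m. (2*t) ^ m /\<^sub>R fact m) sums exp (2*t)" by (rule exp_converges)
    then have "(\<lambda>m. 2*t * ((2*t) ^ m /\<^sub>R fact m)) sums (2*t * exp (2*t))"
      by (rule sums_mult)
    also have "(\<lambda>m. 2*t * ((2*t) ^ m /\<^sub>R fact m)) = (\<lambda>m. real (Suc m) * ((2*t) ^ Suc m /\<^sub>R fact (Suc m)))"
    proof
      fix m
      have "inverse (fact m) = real (Suc m) * inverse (fact (Suc m))"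
        by (simp add: fact_Suc del: of_nat_Suc)
      then show "2*t * ((2*t) ^ m /\<^sub>R fact m) = real (Suc m) * ((2*t) ^ Suc m /\<^sub>R fact (Suc m))"
        unfolding real_scaleR_def power_Suc by (simp only: mult_ac)
    qed
    finally have "(\<lambda>m. real m * ((2*t) ^ m /\<^sub>R fact m)) sums
        (2*t * exp (2*t) + real 0 * ((2*t) ^ 0 /\<^sub>R fact 0))"
      by (rule sums_Suc)
    then show ?thesis by simp
  qed
  have "(\<Sum>m. \<Sum>n\<in>S. (of_int n)\<^sup>2 * (bcoeff m n * t ^ m))
      = (\<Sum>n\<in>S. \<Sum>m. (of_int n)\<^sup>2 * (bcoeff m n * t ^ m))"
    by (rule suminf_sum) (rule summable_mult, rule bcoeff_summable)
  also have "\<dots> = (\<Sum>n\<in>S. (of_int n)\<^sup>2 * (\<Sum>m. bcoeff m n * t ^ m))"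
    by (rule sum.cong[OF refl], rule suminf_mult, rule bcoeff_summable)
  finally have swap: "(\<Sum>m. \<Sum>n\<in>S. (of_int n)\<^sup>2 * (bcoeff m n * t ^ m))
      = (\<Sum>n\<in>S. (of_int n)\<^sup>2 * (\<Sum>m. bcoeff m n * t ^ m))" .
  have "(\<Sum>n\<in>S. (of_int n)\<^sup>2 * heat1 t n)
      = exp (-2*t) * (\<Sum>m. \<Sum>n\<in>S. (of_int n)\<^sup>2 * (bcoeff m n * t ^ m))"
    unfolding heat1_eq swap sum_distrib_left by (simp only: mult.left_commute)
  also have "\<dots> \<le> exp (-2*t) * (2 * t * exp (2*t))"
  proof (intro mult_left_mono)
    have "(\<Sum>m. \<Sum>n\<in>S. (of_int n)\<^sup>2 * (bcoeff m n * t ^ m)) \<le> (\<Sum>m. real m * ((2*t) ^ m /\<^sub>R fact m))"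
    proof (intro suminf_le summable_sum summable_mult bcoeff_summable sums_summable[OF *])
      fix m
      show "(\<Sum>n\<in>S. (of_int n)\<^sup>2 * (bcoeff m n * t ^ m)) \<le> real m * ((2*t) ^ m /\<^sub>R fact m)"
      proof -
        have "(\<Sum>n\<in>S. (of_int n)\<^sup>2 * (bcoeff m n * t ^ m)) = (\<Sum>n\<in>S. (of_int n)\<^sup>2 * bcoeff m n) * t ^ m"
          by (simp add: sum_distrib_right mult.assoc)
        also have "\<dots> \<le> (real m * 2 ^ m / fact m) * t ^ m"
          using assms by (intro mult_right_mono sum_sq_bcoeff_le) auto
        also have "\<dots> = real m * ((2*t) ^ m /\<^sub>R fact m)"
          by (simp add: power_mult_distrib divide_inverse)
        finally show ?thesis .
      qed
    qed
    also have "\<dots> = 2 * t * exp (2*t)" by (rule sums_unique[OF *, symmetric])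
    finally show "(\<Sum>m. \<Sum>n\<in>S. (of_int n)\<^sup>2 * (bcoeff m n * t ^ m)) \<le> 2 * t * exp (2*t)" .
  qed simp
  also have "\<dots> = 2 * t"
  proof -
    have "exp (-2*t) * (2 * t * exp (2*t)) = 2 * t * (exp (2*t) * exp (- (2*t)))"
      unfolding mult_minus_left by (simp only: mult_ac)
    then show ?thesis by (simp only: exp_minus_inverse mult_1_right)
  qed
  finally show ?thesis .
qed

section \<open>The lattice norm and the nearest neighbours\<close>

lemma lnorm_eq_norm: "lnorm x = norm (\<chi> i. real_of_int (x $ i))"
  by (simp add: lnorm_def norm_vec_def L2_set_def)

lemma lnorm_nonneg: "lnorm x \<ge> 0"
  by (simp add: lnorm_eq_norm)

lemma lnorm_power2: "(lnorm x)\<^sup>2 = (\<Sum>i\<in>UNIV. (real_of_int (x $ i))\<^sup>2)"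
  unfolding lnorm_def by (rule real_sqrt_pow2) (simp add: sum_nonneg)

lemma lnorm_uminus: "lnorm (- x) = lnorm x"
  by (simp add: lnorm_def)

lemma lnorm_minus_commute: "lnorm (x - y) = lnorm (y - x)"
  by (metis lnorm_uminus minus_diff_eq)

lemma lnorm_triangle: "lnorm (x + y) \<le> lnorm x + lnorm y"
proof -
  have "(\<chi> i. real_of_int ((x + y) $ i)) = (\<chi> i. real_of_int (x $ i)) + (\<chi> i. real_of_int (y $ i))"
    by (simp add: vec_eq_iff)
  then show ?thesis unfolding lnorm_eq_norm by (metis norm_triangle_ineq)
qed

lemma lnorm_diff_triangle: "\<bar>lnorm x - lnorm y\<bar> \<le> lnorm (x - y)"
  using lnorm_triangle[of "x - y" y] lnorm_triangle[of "y - x" x] lnorm_minus_commute[of x y] by simp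

lemma component_le_lnorm: "\<bar>real_of_int (x $ i)\<bar> \<le> lnorm x"
  using component_le_norm_cart[of "\<chi> i. real_of_int (x $ i)" i] by (simp add: lnorm_eq_norm)

lemma lnorm_ge_1: "x \<noteq> 0 \<Longrightarrow> lnorm x \<ge> 1"
proof -
  assume "x \<noteq> 0"
  then obtain i where "x $ i \<noteq> 0" by (auto simp: vec_eq_iff)
  then have "1 \<le> \<bar>real_of_int (x $ i)\<bar>" by linarith
  then show ?thesis using component_le_lnorm[of x i] by linarith
qed

text \<open>A sum of integer squares equals 1 only if one square is 1 and all others are 0.\<close>

lemma lnorm_eq_1_iff: "lnorm z = 1 \<longleftrightarrow> (\<exists>i. z = axis i 1 \<or> z = - axis i 1)"
proof
  assume z: "lnorm z = 1"
  then have "real_of_int (\<Sum>i\<in>UNIV. (z $ i)\<^sup>2) = 1"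
    using lnorm_power2[of z] by simp
  then have s: "(\<Sum>i\<in>UNIV. (z $ i)\<^sup>2) = 1" by linarith
  have "z \<noteq> 0" using s by auto
  then obtain i where i: "z $ i \<noteq> 0" by (auto simp: vec_eq_iff)
  have s2: "(z $ i)\<^sup>2 + (\<Sum>j\<in>UNIV-{i}. (z $ j)\<^sup>2) = 1"
    using s by (subst (asm) sum.remove[of _ i]) auto
  have "(z $ i)\<^sup>2 \<ge> 1" using i by (simp add: int_one_le_iff_zero_less)
  moreover have "(\<Sum>j\<in>UNIV-{i}. (z $ j)\<^sup>2) \<ge> 0" by (simp add: sum_nonneg)
  ultimately have a: "(z $ i)\<^sup>2 = 1" and b: "(\<Sum>j\<in>UNIV-{i}. (z $ j)\<^sup>2) = 0"
    using s2 by linarith+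
  have c: "z $ j = 0" if "j \<noteq> i" for j
    using b that by (subst (asm) sum_nonneg_eq_0_iff) auto
  from a have "z $ i = 1 \<or> z $ i = - 1" by (simp add: power2_eq_1_iff)
  then have "z = axis i 1 \<or> z = - axis i 1"
    using c by (auto simp: vec_eq_iff axis_def)
  then show "\<exists>i. z = axis i 1 \<or> z = - axis i 1" ..
next
  assume "\<exists>i. z = axis i 1 \<or> z = - axis i 1"
  then obtain i where i: "z = axis i 1 \<or> z = - axis i 1" ..
  have "(real_of_int (axis i 1 $ j))\<^sup>2 = (if j = i then 1 else 0)" for j :: 'a
    by (simp add: axis_def)
  then have "lnorm (axis i 1 :: int ^ 'a) = 1"
    by (simp add: lnorm_def)
  with i show "lnorm z = 1" by (auto simp: lnorm_uminus)
qed

text \<open>The 2d neighbours are pairwise distinct, so they can be grouped by direction. In this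
  form the Laplacian is a sum of one-dimensional ones, which is what makes the heat kernel a
  product.\<close>

lemma dlap_eq:
  "dlap f x = (\<Sum>i\<in>UNIV. 2 * f x - f (x - axis i 1) - f (x + axis i 1))"
proof -
  have eq: "{y. lnorm (y - x) = 1} = range (\<lambda>i. x + axis i 1) \<union> range (\<lambda>i. x - axis i 1)"
    by (auto simp: lnorm_eq_1_iff image_iff algebra_simps eq_diff_eq)
  have ne: "axis i (1::int) \<noteq> - axis j 1" for i j :: 'a
  proof
    assume "axis i (1::int) = - axis j 1"
    then have "axis i (1::int) $ i = (- axis j 1) $ i" by simp
    then show False by (auto simp: axis_def split: if_splits)
  qed
  have disj: "range (\<lambda>i. x + axis i 1) \<inter> range (\<lambda>i. x - axis i 1) = {}"
    using ne by (auto simp: diff_conv_add_uminus simp del: add_uminus_conv_diff)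
  have inj: "inj (\<lambda>i. x + axis i 1)" "inj (\<lambda>i. x - axis i 1)"
    by (auto simp: inj_on_def axis_eq_axis)
  show ?thesis
    unfolding dlap_def eq
    by (subst sum.union_disjoint[OF _ _ disj])
      (auto simp: sum.reindex[OF inj(1)] sum.reindex[OF inj(2)] sum.distrib[symmetric] intro!: sum.cong)
qed

lemma dlap_cmult: "dlap (\<lambda>y. c * f y) x = c * dlap f x"
  by (simp add: dlap_def sum_distrib_left right_diff_distrib)

section \<open>The heat kernel in d dimensions as a product\<close>

lemma fps_deriv_prod:
  fixes f :: "'b \<Rightarrow> 'a::comm_ring_1 fps"
  assumes "finite A"
  shows "fps_deriv (\<Prod>i\<in>A. f i) = (\<Sum>i\<in>A. fps_deriv (f i) * (\<Prod>j\<in>A-{i}. f j))"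
  using assms
proof (induction A)
  case (insert a A)
  have "(\<Sum>i\<in>A. fps_deriv (f i) * (\<Prod>j\<in>insert a A-{i}. f j))
      = (\<Sum>i\<in>A. f a * (fps_deriv (f i) * (\<Prod>j\<in>A-{i}. f j)))"
  proof (intro sum.cong refl)
    fix i assume "i \<in> A"
    then have "insert a A - {i} = insert a (A - {i})" using insert by auto
    then show "fps_deriv (f i) * (\<Prod>j\<in>insert a A-{i}. f j) = f a * (fps_deriv (f i) * (\<Prod>j\<in>A-{i}. f j))"
      using insert by (simp add: mult_ac)
  qed
  with insert show ?case by (simp add: sum_distrib_left algebra_simps)
qed simp

definition heatd_fps :: "int ^ 'd \<Rightarrow> real fps" where
  "heatd_fps x = (\<Prod>i\<in>UNIV. heat_fps (x $ i))"

lemma heatd_fps_split: "heatd_fps x = heat_fps (x $ i) * (\<Prod>j\<in>UNIV-{i}. heat_fps (x $ j))"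
  unfolding heatd_fps_def by (rule prod.remove) auto

lemma fps_deriv_heatd_fps:
  "fps_deriv (heatd_fps x) = (\<Sum>i\<in>UNIV. heatd_fps (x - axis i 1) + heatd_fps (x + axis i 1) - 2 * heatd_fps x)"
proof -
  have 1: "(\<Prod>j\<in>UNIV-{i}. heat_fps ((x - axis i 1) $ j)) = (\<Prod>j\<in>UNIV-{i}. heat_fps (x $ j))"
    and 2: "(\<Prod>j\<in>UNIV-{i}. heat_fps ((x + axis i 1) $ j)) = (\<Prod>j\<in>UNIV-{i}. heat_fps (x $ j))" for i
    by (intro prod.cong; simp add: axis_def)+
  have "fps_deriv (heatd_fps x)
      = (\<Sum>i\<in>UNIV. (heat_fps (x $ i - 1) + heat_fps (x $ i + 1) - 2 * heat_fps (x $ i))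
          * (\<Prod>j\<in>UNIV-{i}. heat_fps (x $ j)))"
    unfolding heatd_fps_def by (subst fps_deriv_prod) (simp_all add: fps_deriv_heat_fps)
  also have "\<dots> = (\<Sum>i\<in>UNIV. heatd_fps (x - axis i 1) + heatd_fps (x + axis i 1) - 2 * heatd_fps x)"
  proof (intro sum.cong refl)
    fix i
    show "(heat_fps (x $ i - 1) + heat_fps (x $ i + 1) - 2 * heat_fps (x $ i))
          * (\<Prod>j\<in>UNIV-{i}. heat_fps (x $ j))
      = heatd_fps (x - axis i 1) + heatd_fps (x + axis i 1) - 2 * heatd_fps x"
      by (simp only: heatd_fps_split[of _ i] 1 2) (simp add: algebra_simps)
  qed
  finally show ?thesis .
qed

text \<open>The time derivative of the product series is minus its lattice Laplacian, and its
  constant term is \<open>ind0\<close>. The coefficients of the exponential series in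
  \<open>heat\<close> obey the same recursion with the same start.\<close>

lemma heatd_fps_nth: "fps_nth (heatd_fps x) n = (- 1) ^ n / fact n * (dlap ^^ n) ind0 x"
proof (induction n arbitrary: x)
  case 0
  have "fps_nth (heat_fps k) 0 = (if k = 0 then 1 else 0)" for k
    by (simp add: heat_fps_def bcoeff_0)
  moreover have "fps_nth (\<Prod>i\<in>A. heat_fps (x $ i)) 0 = (\<Prod>i\<in>A. fps_nth (heat_fps (x $ i)) 0)" for A
    by (induction A rule: infinite_finite_induct) auto
  ultimately have "fps_nth (heatd_fps x) 0 = (\<Prod>i\<in>UNIV. if x $ i = 0 then 1 else 0)"
    unfolding heatd_fps_def by simp
  also have "\<dots> = ind0 x"
    by (cases "x = 0") (auto simp: ind0_def vec_eq_iff)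
  finally show ?case by simp
next
  case (Suc n)
  have "real (Suc n) * fps_nth (heatd_fps x) (Suc n) = fps_nth (fps_deriv (heatd_fps x)) n"
    by simp
  also have "\<dots> = - dlap (\<lambda>y. fps_nth (heatd_fps y) n) x"
    unfolding fps_deriv_heatd_fps dlap_eq
    by (simp add: fps_sum_nth sum_negf[symmetric]) (simp add: algebra_simps)
  also have "\<dots> = - ((- 1) ^ n / fact n * (dlap ^^ Suc n) ind0 x)"
    by (simp only: Suc dlap_cmult) simp
  also have "\<dots> = real (Suc n) * ((- 1) ^ Suc n / fact (Suc n) * (dlap ^^ Suc n) ind0 x)"
    by (simp add: field_simps del: of_nat_Suc)
  finally show ?case by (simp only: mult_cancel_left) simp
qed

lemma eval_fps_prod:
  fixes f :: "'b \<Rightarrow> 'a :: {banach, real_normed_div_algebra, comm_ring_1} fps"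
  assumes "finite A" "\<And>i. i \<in> A \<Longrightarrow> fps_conv_radius (f i) = \<infinity>"
  shows "eval_fps (\<Prod>i\<in>A. f i) z = (\<Prod>i\<in>A. eval_fps (f i) z)"
    and "fps_conv_radius (\<Prod>i\<in>A. f i) = \<infinity>"
proof -
  have "eval_fps (\<Prod>i\<in>A. f i) z = (\<Prod>i\<in>A. eval_fps (f i) z) \<and> fps_conv_radius (\<Prod>i\<in>A. f i) = \<infinity>"
    using assms
  proof (induction A)
    case (insert a A)
    have "fps_conv_radius (f a * (\<Prod>i\<in>A. f i)) = \<infinity>"
      using fps_conv_radius_mult[of "f a" "\<Prod>i\<in>A. f i"] insert by simp
    with insert show ?case by (simp add: eval_fps_mult)
  qed simp
  then show "eval_fps (\<Prod>i\<in>A. f i) z = (\<Prod>i\<in>A. eval_fps (f i) z)"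
    "fps_conv_radius (\<Prod>i\<in>A. f i) = \<infinity>" by auto
qed

lemma heat_ind0: "heat t ind0 x = (\<Prod>i\<in>UNIV. heat1 t (x $ i))"
proof -
  have "heat t ind0 x = (\<Sum>n. fps_nth (heatd_fps x) n * t ^ n)"
    unfolding heat_def heatd_fps_nth by (simp add: power_minus[of t] mult_ac)
  also have "\<dots> = eval_fps (heatd_fps x) t"
    by (simp add: eval_fps_def)
  finally show ?thesis
    unfolding heatd_fps_def heat1_def by (simp add: eval_fps_prod(1) heat_fps_conv_radius)
qed

lemma heat_ind0_nonneg: "t \<ge> 0 \<Longrightarrow> heat t ind0 x \<ge> 0"
  by (simp add: heat_ind0 prod_nonneg heat1_nonneg)

lemma heat_ind0_minus: "heat t ind0 (- x) = heat t ind0 x"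
  by (simp add: heat_ind0 heat1_minus)

lemma continuous_on_heat_ind0: "continuous_on A (\<lambda>t. heat t ind0 x)"
  unfolding heat_ind0 by (intro continuous_intros continuous_on_heat1)

text \<open>Enclosing \<open>F\<close> in a cube makes the sum of products factorise. The size of
  the cube does not matter later, because the one-dimensional bounds hold for all finite
  sets.\<close>

lemma sum_prod_lattice_le:
  fixes g :: "'d::finite \<Rightarrow> int \<Rightarrow> real" and F :: "(int ^ 'd) set"
  assumes "finite F" "\<And>i n. g i n \<ge> 0"
  shows "\<exists>M. (\<Sum>x\<in>F. \<Prod>i\<in>UNIV. g i (x $ i)) \<le> (\<Prod>i\<in>UNIV. \<Sum>n\<in>{-M..M}. g i n)"
proof
  \<comment> \<open>Inserting 0 keeps the set nonempty when \<open>F\<close> is empty.\<close>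
  define M where "M = Max (insert 0 ((\<lambda>(x, i). \<bar>x $ i\<bar>) ` (F \<times> UNIV)))"
  have M: "\<bar>x $ i\<bar> \<le> M" if "x \<in> F" for x i
    unfolding M_def using assms(1) that by (intro Max_ge) (auto intro!: image_eqI[of _ _ "(x, i)"])
  have "(\<Sum>x\<in>F. \<Prod>i\<in>UNIV. g i (x $ i)) = (\<Sum>h\<in>vec_nth ` F. \<Prod>i\<in>UNIV. g i (h i))"
    by (subst sum.reindex) (auto simp: inj_on_def vec_nth_inject)
  also have "\<dots> \<le> (\<Sum>h\<in>PiE UNIV (\<lambda>_. {-M..M}). \<Prod>i\<in>UNIV. g i (h i))"
  proof (intro sum_mono2 finite_PiE prod_nonneg)
    have "x $ i \<in> {-M..M}" if "x \<in> F" for x i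
      using M[OF that, of i] by auto
    then show "vec_nth ` F \<subseteq> PiE UNIV (\<lambda>_. {-M..M})"
      by (auto simp: PiE_def)
  qed (use assms(2) in auto)
  also have "\<dots> = (\<Prod>i\<in>UNIV. \<Sum>n\<in>{-M..M}. g i n)"
    by (subst prod_sum_PiE) auto
  finally show "(\<Sum>x\<in>F. \<Prod>i\<in>UNIV. g i (x $ i)) \<le> (\<Prod>i\<in>UNIV. \<Sum>n\<in>{-M..M}. g i n)" .
qed

lemma sum_heat_ind0_le:
  assumes "t \<ge> 0" "finite F"
  shows "(\<Sum>x\<in>F. heat t ind0 x) \<le> 1"
proof -
  obtain M where "(\<Sum>x\<in>F. \<Prod>i\<in>UNIV. heat1 t (x $ i)) \<le> (\<Prod>i\<in>(UNIV :: 'a set). \<Sum>n\<in>{-M..M}. heat1 t n)"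
    using sum_prod_lattice_le[OF assms(2), of "\<lambda>_. heat1 t"] heat1_nonneg[OF assms(1)] by auto
  also have "\<dots> \<le> 1"
    using assms by (intro prod_le_1) (auto intro!: sum_nonneg heat1_nonneg sum_heat1_le)
  finally show ?thesis by (simp add: heat_ind0)
qed

lemma sum_sq_heat_ind0_le:
  fixes F :: "(int ^ 'd) set"
  assumes "t \<ge> 0" "finite F"
  shows "(\<Sum>x\<in>F. (lnorm x)\<^sup>2 * heat t ind0 x) \<le> 2 * real CARD('d) * t"
proof -
  have *: "(\<Sum>x\<in>F. (of_int (x $ k))\<^sup>2 * heat t ind0 x) \<le> 2 * t" for k
  proof -
    \<comment> \<open>The weight of the k-th coordinate is absorbed into the k-th factor, which is
      bounded by the second moment; the other factors are bounded by the mass.\<close>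
    define g where "g i n = (if i = k then (of_int n)\<^sup>2 else 1) * heat1 t n" for i n
    have g0: "g i n \<ge> 0" for i n
      by (simp add: g_def heat1_nonneg assms)
    obtain M where M: "(\<Sum>x\<in>F. \<Prod>i\<in>UNIV. g i (x $ i)) \<le> (\<Prod>i\<in>UNIV. \<Sum>n\<in>{-M..M}. g i n)"
      using sum_prod_lattice_le[OF assms(2), of g, OF g0] by auto
    have "(\<Prod>i\<in>UNIV. g i (x $ i)) = (of_int (x $ k))\<^sup>2 * heat t ind0 x" for x
      by (simp add: g_def prod.distrib heat_ind0)
    with M have "(\<Sum>x\<in>F. (of_int (x $ k))\<^sup>2 * heat t ind0 x) \<le> (\<Prod>i\<in>UNIV. \<Sum>n\<in>{-M..M}. g i n)"
      by simp
    also have "\<dots> = (\<Sum>n\<in>{-M..M}. g k n) * (\<Prod>i\<in>UNIV-{k}. \<Sum>n\<in>{-M..M}. g i n)"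
      by (rule prod.remove) auto
    also have "\<dots> \<le> (2 * t) * 1"
    proof (intro mult_mono prod_le_1)
      show "(\<Sum>n\<in>{-M..M}. g k n) \<le> 2 * t"
        using sum_sq_heat1_le[OF assms(1)] by (simp add: g_def)
      show "0 \<le> (\<Sum>n\<in>{-M..M}. g i n) \<and> (\<Sum>n\<in>{-M..M}. g i n) \<le> 1" if "i \<in> UNIV - {k}" for i
        using that sum_heat1_le[OF assms(1)] by (auto simp: g_def intro!: sum_nonneg heat1_nonneg assms)
    qed (use assms g0 in \<open>auto intro!: prod_nonneg sum_nonneg\<close>)
    finally show ?thesis by simp
  qed
  have "(\<Sum>x\<in>F. (lnorm x)\<^sup>2 * heat t ind0 x) = (\<Sum>k\<in>UNIV. \<Sum>x\<in>F. (of_int (x $ k))\<^sup>2 * heat t ind0 x)"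
    by (subst sum.swap) (simp add: lnorm_power2 sum_distrib_right)
  also have "\<dots> \<le> (\<Sum>k\<in>(UNIV :: 'd set). 2 * t)"
    by (intro sum_mono *)
  finally show ?thesis by simp
qed

section \<open>Lower bound for the heat kernel on the diffusive scale\<close>

text \<open>Stirling bound k! \<le> e k^(k + 1/2) e^(-k). The step from k to k + 1 needs (k + 1/2)
  (ln (k + 1) - ln k) \<ge> 1, and the midpoint estimate for the integral of 1/x gives exactly
  this.\<close>

lemma ln_fact_le: "k \<ge> 1 \<Longrightarrow> ln (fact k :: real) \<le> 1 + (real k + 1/2) * ln (real k) - real k"
proof (induction k rule: dec_induct)
  case base
  then show ?case by simp
next
  case (step k)
  have k: "real k > 0" using step by simp
  have "2 * (real (Suc k) - real k) / (real k + real (Suc k)) \<le> ln (real (Suc k)) - ln (real k)"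
    using k by (intro ln_inverse_approx_ge) auto
  then have "2 / (2 * real k + 1) \<le> ln (real (Suc k)) - ln (real k)"
    by (simp add: algebra_simps)
  then have "(2 * real k + 1) / 2 * (2 / (2 * real k + 1)) \<le> (2 * real k + 1) / 2 * (ln (real (Suc k)) - ln (real k))"
    by (intro mult_left_mono) auto
  then have 1: "1 \<le> (real k + 1/2) * (ln (real (Suc k)) - ln (real k))"
    using k by (simp add: field_simps del: of_nat_Suc)
  have "ln (fact (Suc k) :: real) = ln (real (Suc k)) + ln (fact k)"
    using ln_mult[of "real (Suc k)" "fact k"] by (simp add: fact_Suc del: of_nat_Suc)
  also have "\<dots> \<le> ln (real (Suc k)) + (1 + (real k + 1/2) * ln (real k) - real k)"
    using step by simp
  also have "\<dots> \<le> 1 + (real (Suc k) + 1/2) * ln (real (Suc k)) - real (Suc k)"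
    using 1 by (simp add: algebra_simps)
  finally show ?case .
qed

text \<open>Poisson weights up to two standard deviations above the mean t are of order 1/sqrt t.
  The exponent 5 is 1 from Stirling plus 4 from (k - t)^2/t \<le> 4, and 3t bounds k in the square
  root.\<close>

lemma poisson_weight_ge:
  assumes "t \<ge> 1" "t \<le> real k" "real k \<le> t + 2 * sqrt t"
  shows "exp (- t) * t ^ k / fact k \<ge> exp (- 5) / sqrt (3 * t)"
proof -
  have k: "real k > 0" and k1: "k \<ge> 1" using assms by auto
  have st: "sqrt t \<le> t" using assms(1) by (simp add: real_le_lsqrt self_le_power power2_eq_square)
  have k3: "real k \<le> 3 * t" using assms(3) st by linarith
  have "(real k - t)\<^sup>2 \<le> (2 * sqrt t)\<^sup>2" using assms by (intro power_mono) auto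
  then have sq: "(real k - t)\<^sup>2 \<le> 4 * t" using assms(1) by (simp add: power_mult_distrib)
  have "ln (real k / t) \<le> real k / t - 1"
    using k assms(1) by (intro ln_le_minus_one) auto
  then have "real k * ln (real k / t) \<le> real k * (real k / t - 1)"
    by (intro mult_left_mono) auto
  also have "\<dots> = (real k - t) + (real k - t)\<^sup>2 / t"
    using assms(1) by (simp add: field_simps power2_eq_square)
  also have "\<dots> \<le> (real k - t) + 4"
    using sq assms(1) by (simp add: divide_le_eq)
  finally have 1: "real k * (ln (real k) - ln t) \<le> (real k - t) + 4"
    using k assms(1) by (simp add: ln_div)
  have "ln (real k) \<le> ln (3 * t)" using k k3 by simp
  then have "- 5 - ln (3 * t) / 2 \<le> - t + real k * ln t - ln (fact k)"
    using 1 ln_fact_le[OF k1] by (simp add: algebra_simps)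
  then have "exp (- 5 - ln (3 * t) / 2) \<le> exp (- t + real k * ln t - ln (fact k))"
    by simp
  also have "\<dots> = exp (- t) * t ^ k / fact k"
    using assms(1) by (simp add: exp_diff exp_add exp_of_nat_mult exp_minus field_simps)
  also have "exp (- 5 - ln (3 * t) / 2) = exp (- 5) / sqrt (3 * t)"
  proof -
    have "ln (3 * t) / 2 = ln (sqrt (3 * t))" using assms(1) by (simp add: ln_sqrt)
    then show ?thesis using assms(1) by (simp add: exp_diff)
  qed
  finally show ?thesis .
qed

lemma bcoeff_nat: "bcoeff (2 * k + n) (int n) = 1 / (fact (k + n) * fact k)"
proof -
  have 1: "int (2 * k + n) + int n = 2 * (int k + int n)" "int (2 * k + n) - int n = 2 * int k"
    by auto
  show ?thesis unfolding bcoeff_def 1 by (simp add: ifact_def nat_add_distrib divide_inverse)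
qed

text \<open>For n \<ge> 0 the term of index 2k + n is the product of the Poisson weights of mean t
  at k and k + n. About sqrt t values of k keep both within two standard deviations, and each such
  term is at least of order 1/t.\<close>

lemma heat1_ge:
  assumes "t \<ge> 1" "\<bar>real_of_int n\<bar> \<le> sqrt t"
  shows "heat1 t n \<ge> (exp (- 10) / 6) / sqrt t"
proof -
  define m where "m = nat \<bar>n\<bar>"
  have m: "real m \<le> sqrt t" using assms(2) by (simp add: m_def)
  have hm: "heat1 t n = heat1 t (int m)"
    using heat1_minus[of t n] by (cases "n \<ge> 0") (auto simp: m_def)
  \<comment> \<open>The values of k are a + j with j < b. Since j + 1 \<le> b, the rounding error of
    the ceiling is absorbed and a + j + m \<le> t + 2 sqrt t.\<close>
  define a where "a = nat \<lceil>t\<rceil>"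
  define b where "b = nat \<lfloor>sqrt t\<rfloor>"
  have a: "t \<le> real a" "real a \<le> t + 1" using assms(1) unfolding a_def by linarith+
  have s1: "sqrt t \<ge> 1" using assms(1) by simp
  have "\<lfloor>sqrt t\<rfloor> \<ge> 1" using s1 by simp
  then have b: "real b \<le> sqrt t" "sqrt t / 2 \<le> real b" unfolding b_def by linarith+
  let ?c = "exp (- 5) / sqrt (3 * t)"
  have "sqrt t / 2 * (?c * ?c) \<le> real b * (?c * ?c)"
    using b assms(1) by (intro mult_right_mono) auto
  also have "\<dots> = (\<Sum>j<b. ?c * ?c)"
    by simp
  also have "\<dots> \<le> (\<Sum>j<b. exp (-2*t) * (bcoeff (2 * (a + j) + m) (int m) * t ^ (2 * (a + j) + m)))"
  proof (intro sum_mono)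
    fix j assume "j \<in> {..<b}"
    then have j: "real j + 1 \<le> real b" by auto
    have "?c * ?c \<le> (exp (- t) * t ^ (a + j) / fact (a + j)) * (exp (- t) * t ^ (a + j + m) / fact (a + j + m))"
      using assms(1) a b j m by (intro mult_mono poisson_weight_ge) auto
    also have "\<dots> = exp (-2*t) * (bcoeff (2 * (a + j) + m) (int m) * t ^ (2 * (a + j) + m))"
    proof -
      have "exp (-2*t) = exp (-t) * exp (-t)" by (simp only: exp_add[symmetric]) simp
      moreover have "t ^ (2 * (a + j) + m) = t ^ (a + j) * t ^ (a + j + m)"
      proof -
        have "2 * (a + j) + m = (a + j) + (a + j + m)" by simp
        then show ?thesis by (simp only: power_add)
      qed
      ultimately show ?thesis unfolding bcoeff_nat by (simp add: mult_ac)
    qed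
    finally show "?c * ?c \<le> exp (-2*t) * (bcoeff (2 * (a + j) + m) (int m) * t ^ (2 * (a + j) + m))" .
  qed
  also have "\<dots> = exp (-2*t) * (\<Sum>i\<in>(\<lambda>j. 2 * (a + j) + m) ` {..<b}. bcoeff i (int m) * t ^ i)"
    by (subst sum.reindex) (auto simp: inj_on_def sum_distrib_left)
  also have "\<dots> \<le> exp (-2*t) * (\<Sum>i. bcoeff i (int m) * t ^ i)"
    using assms(1) by (intro mult_left_mono sum_le_suminf bcoeff_summable)
      (auto intro!: mult_nonneg_nonneg bcoeff_nonneg)
  also have "\<dots> = heat1 t n" unfolding hm by (simp only: heat1_eq)
  finally have "sqrt t / 2 * (?c * ?c) \<le> heat1 t n" .
  moreover have "sqrt t / 2 * (?c * ?c) = (exp (- 10) / 6) / sqrt t"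
  proof -
    have "?c * ?c = (exp (- 5) * exp (- 5)) / (3 * t)" using assms(1) by simp
    also have "exp (- 5) * exp (- 5) = (exp (- 10) :: real)" by (simp only: exp_add[symmetric]) simp
    finally have e: "?c * ?c = exp (- 10) / (3 * t)" .
    have "sqrt t * sqrt t = t" using assms(1) by simp
    then show ?thesis unfolding e using s1 assms(1) by (simp add: field_simps)
  qed
  ultimately show ?thesis by simp
qed

lemma heat_ind0_ge:
  fixes x :: "int ^ 'd"
  assumes "t \<ge> 1" "lnorm x \<le> sqrt t"
  shows "heat t ind0 x \<ge> ((exp (- 10) / 6) / sqrt t) ^ CARD('d)"
proof -
  have "(\<Prod>i\<in>(UNIV :: 'd set). (exp (- 10) / 6) / sqrt t) \<le> (\<Prod>i\<in>UNIV. heat1 t (x $ i))"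
    using assms component_le_lnorm[of x]
    by (intro prod_mono conjI heat1_ge) (auto intro: order_trans)
  then show ?thesis by (simp add: heat_ind0)
qed

section \<open>Integrals in time\<close>

text \<open>Transfer from the gauge integral. The intervals with and without the endpoint 0 give the
  same function, since \<open>0 powr a = 0\<close>.\<close>

lemma has_bochner_integral_powr_from_0:
  fixes a c :: real
  assumes "a > - 1" "c \<ge> 0"
  shows "has_bochner_integral lborel (\<lambda>t. indicator {0<..c} t * t powr a) (c powr (a + 1) / (a + 1))"
proof (rule has_bochner_integral_nn_integral)
  have "((\<lambda>t. if t \<in> {0..c} then t powr a else 0) has_integral (c powr (a + 1) / (a + 1))) UNIV"
    using has_integral_powr_from_0[OF assms] by (simp only: has_integral_restrict_UNIV)
  also have "(\<lambda>t. if t \<in> {0..c} then t powr a else 0) = (\<lambda>t. indicator {0<..c} t * t powr a)"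
    by (auto simp: fun_eq_iff indicator_def)
  finally show "integral\<^sup>N lborel (\<lambda>t. indicator {0<..c} t * t powr a) = ennreal (c powr (a + 1) / (a + 1))"
    by (intro nn_integral_has_integral_lborel) auto
qed (use assms in auto)

lemma has_bochner_integral_powr_to_inf:
  fixes a e :: real
  assumes "e < - 1" "a > 0"
  shows "has_bochner_integral lborel (\<lambda>t. indicator {a..} t * t powr e) (- (a powr (e + 1)) / (e + 1))"
proof (rule has_bochner_integral_nn_integral)
  have "((\<lambda>t. if t \<in> {a..} then t powr e else 0) has_integral (- (a powr (e + 1)) / (e + 1))) UNIV"
    using has_integral_powr_to_inf[OF assms] by (simp only: has_integral_restrict_UNIV)
  also have "(\<lambda>t. if t \<in> {a..} then t powr e else 0) = (\<lambda>t. indicator {a..} t * t powr e)"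
    by (auto simp: fun_eq_iff indicator_def)
  finally show "integral\<^sup>N lborel (\<lambda>t. indicator {a..} t * t powr e) = ennreal (- (a powr (e + 1)) / (e + 1))"
    by (intro nn_integral_has_integral_lborel) auto
qed (use assms in \<open>auto simp: field_simps\<close>)

lemma sum_truncated_heat_le:
  fixes F :: "(int ^ 'd) set"
  assumes "t > 0" "R > 0" "finite F"
  shows "(\<Sum>z\<in>F. min 1 ((lnorm z)\<^sup>2 / R\<^sup>2) * heat t ind0 z) \<le> min 1 (2 * real CARD('d) * t / R\<^sup>2)"
proof (rule min.boundedI)
  have "(\<Sum>z\<in>F. min 1 ((lnorm z)\<^sup>2 / R\<^sup>2) * heat t ind0 z) \<le> (\<Sum>z\<in>F. 1 * heat t ind0 z)"
    using assms by (intro sum_mono mult_right_mono heat_ind0_nonneg) auto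
  also have "\<dots> \<le> 1" using sum_heat_ind0_le[of t F] assms by simp
  finally show "(\<Sum>z\<in>F. min 1 ((lnorm z)\<^sup>2 / R\<^sup>2) * heat t ind0 z) \<le> 1" .
  have "(\<Sum>z\<in>F. min 1 ((lnorm z)\<^sup>2 / R\<^sup>2) * heat t ind0 z) \<le> (\<Sum>z\<in>F. (lnorm z)\<^sup>2 / R\<^sup>2 * heat t ind0 z)"
    using assms by (intro sum_mono mult_right_mono heat_ind0_nonneg) auto
  also have "\<dots> = (\<Sum>z\<in>F. (lnorm z)\<^sup>2 * heat t ind0 z) / R\<^sup>2"
    by (simp add: sum_divide_distrib)
  also have "\<dots> \<le> 2 * real CARD('d) * t / R\<^sup>2"
    using sum_sq_heat_ind0_le[of t F] assms by (intro divide_right_mono) auto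
  finally show "(\<Sum>z\<in>F. min 1 ((lnorm z)\<^sup>2 / R\<^sup>2) * heat t ind0 z) \<le> 2 * real CARD('d) * t / R\<^sup>2" .
qed

subsection \<open>The Riesz kernel\<close>

definition heat_density :: "real \<Rightarrow> int ^ 'd \<Rightarrow> real \<Rightarrow> real" where
  "heat_density \<sigma> x t = indicator {0<..} t * (heat t ind0 x * t powr (- (1 + \<sigma>)))"

text \<open>Majorant in t for the kernel truncated at scale R: the second moment is used up to time
  R^2 and the mass from then on. The argument \<open>D\<close> only carries the dimension.\<close>

definition truncated_density :: "real \<Rightarrow> 'd itself \<Rightarrow> real \<Rightarrow> real \<Rightarrow> real" where
  "truncated_density \<sigma> D R t = 2 * real CARD('d) / R\<^sup>2 * (indicator {0<..R\<^sup>2} t * t powr (- \<sigma>))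
     + indicator {R\<^sup>2..} t * t powr (- (1 + \<sigma>))"

lemma kappa_eq: "x \<noteq> 0 \<Longrightarrow> kappa \<sigma> x = 1 / \<bar>Gamma (- \<sigma>)\<bar> * (LINT t|lborel. heat_density \<sigma> x t)"
  by (simp add: kappa_def set_lebesgue_integral_def heat_density_def)

lemma heat_density_nonneg: "heat_density \<sigma> x t \<ge> 0"
  by (auto simp: heat_density_def indicator_def heat_ind0_nonneg)

lemma heat_density_measurable: "heat_density \<sigma> x \<in> borel_measurable lborel"
proof -
  have [measurable]: "(\<lambda>t. heat t ind0 x) \<in> borel_measurable borel"
    by (intro borel_measurable_continuous_onI continuous_on_heat_ind0)
  show ?thesis unfolding heat_density_def by measurable
qed

text \<open>The exponent -\<sigma> is integrable at 0 as \<sigma> < 1, and -(1 + \<sigma>) at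
  infinity as \<sigma> > 0. Splitting at R^2 makes both pieces multiples of R^(-2\<sigma>).\<close>

lemma has_bochner_integral_truncated_density:
  assumes "0 < \<sigma>" "\<sigma> < 1" "R > 0"
  shows "has_bochner_integral lborel (truncated_density \<sigma> TYPE('d::finite) R)
    ((2 * real CARD('d) / (1 - \<sigma>) + 1 / \<sigma>) * R powr (- 2 * \<sigma>))"
proof -
  have R2: "R\<^sup>2 = R powr 2" using assms by simp
  have "(R\<^sup>2) powr (- \<sigma> + 1) = R powr (- 2 * \<sigma> + 2)"
    unfolding R2 powr_powr by (simp add: algebra_simps)
  then have e1: "(R\<^sup>2) powr (- \<sigma> + 1) = R powr (- 2 * \<sigma>) * R\<^sup>2"
    unfolding powr_add R2 .
  have e2: "(R\<^sup>2) powr (- (1 + \<sigma>) + 1) = R powr (- 2 * \<sigma>)"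
    unfolding R2 powr_powr by simp
  have "has_bochner_integral lborel (truncated_density \<sigma> TYPE('d::finite) R)
     (2 * real CARD('d) / R\<^sup>2 * ((R\<^sup>2) powr (- \<sigma> + 1) / (- \<sigma> + 1))
      + - ((R\<^sup>2) powr (- (1 + \<sigma>) + 1)) / (- (1 + \<sigma>) + 1))"
    unfolding truncated_density_def using assms
    by (intro has_bochner_integral_add has_bochner_integral_mult_right
      has_bochner_integral_powr_from_0 has_bochner_integral_powr_to_inf) auto
  moreover have "(2 * real CARD('d) / R\<^sup>2 * ((R\<^sup>2) powr (- \<sigma> + 1) / (- \<sigma> + 1))
      + - ((R\<^sup>2) powr (- (1 + \<sigma>) + 1)) / (- (1 + \<sigma>) + 1))
    = (2 * real CARD('d) / (1 - \<sigma>) + 1 / \<sigma>) * R powr (- 2 * \<sigma>)"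
    unfolding e1 e2 using assms by (simp add: field_simps)
  ultimately show ?thesis by simp
qed

lemma sum_heat_density_le:
  fixes F :: "(int ^ 'd) set"
  assumes "R > 0" "finite F"
  shows "(\<Sum>z\<in>F. min 1 ((lnorm z)\<^sup>2 / R\<^sup>2) * heat_density \<sigma> z t) \<le> truncated_density \<sigma> TYPE('d) R t"
proof (cases "t > 0")
  case True
  have "(\<Sum>z\<in>F. min 1 ((lnorm z)\<^sup>2 / R\<^sup>2) * heat_density \<sigma> z t)
      = (\<Sum>z\<in>F. min 1 ((lnorm z)\<^sup>2 / R\<^sup>2) * heat t ind0 z) * t powr (- (1 + \<sigma>))"
    using True by (simp add: heat_density_def sum_distrib_right mult.assoc)
  also have "\<dots> \<le> min 1 (2 * real CARD('d) * t / R\<^sup>2) * t powr (- (1 + \<sigma>))"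
    using sum_truncated_heat_le[OF True assms] by (intro mult_right_mono) auto
  also have "\<dots> \<le> truncated_density \<sigma> TYPE('d) R t"
  proof (cases "t \<le> R\<^sup>2")
    case le: True
    have "min 1 (2 * real CARD('d) * t / R\<^sup>2) * t powr (- (1 + \<sigma>))
      \<le> (2 * real CARD('d) * t / R\<^sup>2) * t powr (- (1 + \<sigma>))"
      by (intro mult_right_mono) auto
    also have "\<dots> = 2 * real CARD('d) / R\<^sup>2 * t powr (- \<sigma>)"
      using True by (simp add: powr_diff powr_minus field_simps powr_add)
    also have "\<dots> \<le> truncated_density \<sigma> TYPE('d) R t"
      using True le by (simp add: truncated_density_def)
    finally show ?thesis .
  next
    case False
    have "min 1 (2 * real CARD('d) * t / R\<^sup>2) * t powr (- (1 + \<sigma>)) \<le> 1 * t powr (- (1 + \<sigma>))"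
      by (intro mult_right_mono) auto
    then show ?thesis using False by (simp add: truncated_density_def)
  qed
  finally show ?thesis .
next
  case False
  then show ?thesis by (auto simp: heat_density_def truncated_density_def indicator_def)
qed

text \<open>For the single point x and R = |x| the truncation factor is 1, so the majorant dominates
  the density itself.\<close>

lemma integrable_heat_density:
  fixes x :: "int ^ 'd"
  assumes "0 < \<sigma>" "\<sigma> < 1" "x \<noteq> 0"
  shows "integrable lborel (heat_density \<sigma> x)"
proof (rule Bochner_Integration.integrable_bound)
  have x: "lnorm x > 0" using lnorm_ge_1[OF assms(3)] by simp
  show "integrable lborel (truncated_density \<sigma> TYPE('d) (lnorm x))"
    using has_bochner_integral_truncated_density[OF assms(1,2) x] by (rule integrable.intros)
  have "heat_density \<sigma> x t \<le> truncated_density \<sigma> TYPE('d) (lnorm x) t" for t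
    using sum_heat_density_le[OF x, of "{x}" \<sigma> t] x by simp
  then show "AE t in lborel. norm (heat_density \<sigma> x t) \<le> norm (truncated_density \<sigma> TYPE('d) (lnorm x) t)"
    by (intro AE_I2) (simp add: heat_density_nonneg order_trans[OF _ abs_ge_self])
qed (rule heat_density_measurable)

lemma kappa_0: "kappa \<sigma> 0 = 0"
  by (simp add: kappa_def)

lemma kappa_minus: "kappa \<sigma> (- x) = kappa \<sigma> x"
  by (simp add: kappa_def heat_ind0_minus)

lemma kappa_commute: "kappa \<sigma> (x - y) = kappa \<sigma> (y - x)"
  by (metis kappa_minus minus_diff_eq)

lemma kappa_nonneg: "kappa \<sigma> x \<ge> 0"
  by (cases "x = 0") (auto simp: kappa_0 kappa_eq intro!: mult_nonneg_nonneg divide_nonneg_nonneg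
    integral_nonneg_AE heat_density_nonneg)

text \<open>Obtained by integrating the majorant over time. It later measures the energy of a cutoff
  that varies on scale R.\<close>

lemma sum_truncated_kappa_le:
  assumes "0 < \<sigma>" "\<sigma> < 1"
  obtains C where "C > 0" "\<And>R (F :: (int ^ 'd) set). R > 0 \<Longrightarrow> finite F \<Longrightarrow>
    (\<Sum>z\<in>F. min 1 ((lnorm z)\<^sup>2 / R\<^sup>2) * kappa \<sigma> z) \<le> C * R powr (- 2 * \<sigma>)"
proof
  define I where "I = 2 * real CARD('d) / (1 - \<sigma>) + 1 / \<sigma>"
  \<comment> \<open>The summand 1 makes C positive whatever the value of the Gamma factor.\<close>
  define C where "C = 1 + 1 / \<bar>Gamma (- \<sigma>)\<bar> * I"
  have I: "I \<ge> 0" using assms by (auto simp: I_def intro!: add_nonneg_nonneg divide_nonneg_nonneg)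
  then have "1 / \<bar>Gamma (- \<sigma>)\<bar> * I \<ge> 0" by simp
  then show "C > 0" unfolding C_def by linarith
  fix R :: real and F :: "(int ^ 'd) set" assume R: "R > 0" and F: "finite F"
  \<comment> \<open>The origin is split off because \<open>kappa\<close> is 0 there by definition
    and not by the integral formula.\<close>
  have "(\<Sum>z\<in>F. min 1 ((lnorm z)\<^sup>2 / R\<^sup>2) * kappa \<sigma> z) = (\<Sum>z\<in>F-{0}. min 1 ((lnorm z)\<^sup>2 / R\<^sup>2) * kappa \<sigma> z)"
    using F by (intro sum.mono_neutral_right) (auto simp: kappa_0)
  also have "\<dots> = (\<Sum>z\<in>F-{0}. 1 / \<bar>Gamma (- \<sigma>)\<bar> * (LINT t|lborel. min 1 ((lnorm z)\<^sup>2 / R\<^sup>2) * heat_density \<sigma> z t))"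
    by (intro sum.cong) (auto simp: kappa_eq mult.left_commute)
  also have "\<dots> = 1 / \<bar>Gamma (- \<sigma>)\<bar> * (LINT t|lborel. (\<Sum>z\<in>F-{0}. min 1 ((lnorm z)\<^sup>2 / R\<^sup>2) * heat_density \<sigma> z t))"
    by (subst Bochner_Integration.integral_sum)
      (auto simp: sum_distrib_left intro!: integrable_heat_density assms)
  also have "(LINT t|lborel. (\<Sum>z\<in>F-{0}. min 1 ((lnorm z)\<^sup>2 / R\<^sup>2) * heat_density \<sigma> z t))
      \<le> (LINT t|lborel. truncated_density \<sigma> TYPE('d) R t)"
  proof (intro integral_mono sum_heat_density_le R)
    show "integrable lborel (truncated_density \<sigma> TYPE('d) R)"
      using has_bochner_integral_truncated_density[OF assms R] by (rule integrable.intros)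
    show "integrable lborel (\<lambda>t. \<Sum>z\<in>F-{0}. min 1 ((lnorm z)\<^sup>2 / R\<^sup>2) * heat_density \<sigma> z t)"
      by (intro Bochner_Integration.integrable_sum integrable_mult_right integrable_heat_density assms) auto
  qed (use F in auto)
  also have "\<dots> = I * R powr (- 2 * \<sigma>)"
    unfolding I_def by (rule has_bochner_integral_integral_eq[OF has_bochner_integral_truncated_density[OF assms R]])
  also have "1 / \<bar>Gamma (- \<sigma>)\<bar> * (I * R powr (- 2 * \<sigma>)) = (1 / \<bar>Gamma (- \<sigma>)\<bar> * I) * R powr (- 2 * \<sigma>)"
    by simp
  also have "\<dots> \<le> C * R powr (- 2 * \<sigma>)"
    unfolding C_def by (intro mult_right_mono) auto
  finally show "(\<Sum>z\<in>F. min 1 ((lnorm z)\<^sup>2 / R\<^sup>2) * kappa \<sigma> z) \<le> C * R powr (- 2 * \<sigma>)"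
    by (simp add: divide_right_mono)
qed

text \<open>Only times between r^2 and 2 r^2 with r = |x| are kept. There the heat kernel is at
  least of order r^(-d) and the power of t of order r^(-2 - 2\<sigma>), while the interval has
  length r^2.\<close>

lemma kappa_ge:
  assumes "0 < \<sigma>" "\<sigma> < 1"
  obtains c where "c > 0" "\<And>x :: int ^ 'd. x \<noteq> 0 \<Longrightarrow> c * lnorm x powr (- (real CARD('d) + 2 * \<sigma>)) \<le> kappa \<sigma> x"
proof
  \<comment> \<open>The constant of \<open>heat_ind0_ge\<close> divided by sqrt 2, since sqrt t
    \<le> sqrt 2 * r on the chosen interval.\<close>
  define c0 where "c0 = exp (- 10) / 6 / sqrt (2 :: real)"
  define c where "c = 1 / \<bar>Gamma (- \<sigma>)\<bar> * (c0 ^ CARD('d) * 2 powr (- (1 + \<sigma>)))"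
  \<comment> \<open>At a pole \<open>Gamma\<close> has the default value 0, which would make the
    prefactor vanish; strictly between -1 and 0 there is no pole.\<close>
  have "- \<sigma> \<notin> \<int>\<^sub>\<le>\<^sub>0"
  proof
    assume "- \<sigma> \<in> \<int>\<^sub>\<le>\<^sub>0"
    then obtain n where "- \<sigma> = of_int n" by (auto elim: nonpos_Ints_cases)
    then have "n < 0" "n > - 1" using assms by linarith+
    then show False by simp
  qed
  then have "Gamma (- \<sigma>) \<noteq> 0" by (simp add: Gamma_eq_zero_iff)
  then show "c > 0" by (simp add: c_def c0_def)
  fix x :: "int ^ 'd" assume x: "x \<noteq> 0"
  define r where "r = lnorm x"
  have r: "r \<ge> 1" using lnorm_ge_1[OF x] by (simp add: r_def)
  define L where "L = (c0 / r) ^ CARD('d) * (2 * r\<^sup>2) powr (- (1 + \<sigma>))"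
  have "indicator {r\<^sup>2..2*r\<^sup>2} t * L \<le> heat_density \<sigma> x t" for t
  proof (cases "t \<in> {r\<^sup>2..2*r\<^sup>2}")
    case True
    then have t: "r\<^sup>2 \<le> t" "t \<le> 2 * r\<^sup>2" by auto
    have "r\<^sup>2 \<ge> 1" using r by simp
    then have t1: "t \<ge> 1" using t by linarith
    have st: "sqrt t \<le> sqrt 2 * r" using t r by (simp add: real_sqrt_le_iff real_sqrt_mult real_le_lsqrt power_mult_distrib)
    have "c0 / r \<le> exp (- 10) / 6 / sqrt t"
      unfolding c0_def using st t1 r by (simp add: divide_le_cancel frac_le)
    then have "(c0 / r) ^ CARD('d) \<le> (exp (- 10) / 6 / sqrt t) ^ CARD('d)"
      using r by (intro power_mono) (auto simp: c0_def)
    also have "\<dots> \<le> heat t ind0 x"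
      using t r by (intro heat_ind0_ge t1) (auto simp: r_def intro: real_le_rsqrt)
    finally have "(c0 / r) ^ CARD('d) \<le> heat t ind0 x" .
    moreover have "(2 * r\<^sup>2) powr (- (1 + \<sigma>)) \<le> t powr (- (1 + \<sigma>))"
      using t t1 assms by (intro powr_mono2') auto
    ultimately have "L \<le> heat t ind0 x * t powr (- (1 + \<sigma>))"
      unfolding L_def using t1 by (intro mult_mono heat_ind0_nonneg) auto
    then show ?thesis using True t1 by (simp add: heat_density_def)
  qed (simp add: heat_density_nonneg)
  then have "(LINT t|lborel. indicator {r\<^sup>2..2*r\<^sup>2} t * L) \<le> (LINT t|lborel. heat_density \<sigma> x t)"
    by (intro integral_mono integrable_heat_density assms x integrable_mult_left integrable_real_indicator) auto
  also have "(LINT t|lborel. indicator {r\<^sup>2..2*r\<^sup>2} t * L) = r\<^sup>2 * L"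
    by simp
  finally have "1 / \<bar>Gamma (- \<sigma>)\<bar> * (r\<^sup>2 * L) \<le> kappa \<sigma> x"
    unfolding kappa_eq[OF x] by (intro mult_left_mono) auto
  moreover have "r\<^sup>2 * L = c0 ^ CARD('d) * 2 powr (- (1 + \<sigma>)) * r powr (- (real CARD('d) + 2 * \<sigma>))"
  proof -
    have "(2 * r\<^sup>2) powr (- (1 + \<sigma>)) = 2 powr (- (1 + \<sigma>)) * (r powr 2) powr (- (1 + \<sigma>))"
      using r by (simp add: powr_mult)
    also have "(r powr 2) powr (- (1 + \<sigma>)) = r powr (- 2 - 2 * \<sigma>)"
      unfolding powr_powr by (simp add: algebra_simps)
    finally have 1: "(2 * r\<^sup>2) powr (- (1 + \<sigma>)) = 2 powr (- (1 + \<sigma>)) * r powr (- 2 - 2 * \<sigma>)" .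
    have 2: "(c0 / r) ^ CARD('d) = c0 ^ CARD('d) * r powr (- real CARD('d))"
      using r by (simp add: powr_minus powr_realpow divide_inverse power_mult_distrib power_inverse)
    have 3: "r\<^sup>2 = r powr 2" using r by simp
    have "r\<^sup>2 * L = c0 ^ CARD('d) * 2 powr (- (1 + \<sigma>)) * (r powr 2 * r powr (- real CARD('d)) * r powr (- 2 - 2 * \<sigma>))"
      unfolding L_def 1 2 unfolding 3 by (simp only: mult_ac)
    also have "r powr 2 * r powr (- real CARD('d)) * r powr (- 2 - 2 * \<sigma>) = r powr (- (real CARD('d) + 2 * \<sigma>))"
      unfolding powr_add[symmetric] by (simp add: algebra_simps)
    finally show ?thesis .
  qed
  ultimately show "c * lnorm x powr (- (real CARD('d) + 2 * \<sigma>)) \<le> kappa \<sigma> x"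
    by (simp add: c_def r_def mult_ac)
qed

subsection \<open>Cutoffs of small energy\<close>

text \<open>Restricting to a set P of pairs lets the full energy be controlled by bounds uniform
  over finite P, without any summability statement.\<close>

definition energy :: "('x \<Rightarrow> 'x \<Rightarrow> real) \<Rightarrow> ('x \<Rightarrow> real) \<Rightarrow> ('x \<times> 'x) set \<Rightarrow> real" where
  "energy a e P = (\<Sum>(x, y)\<in>P. a x y * (e x - e y)\<^sup>2)"

lemma energy_mono:
  "(\<And>x y. a x y \<ge> 0) \<Longrightarrow> finite Q \<Longrightarrow> P \<subseteq> Q \<Longrightarrow> energy a e P \<le> energy a e Q"
  unfolding energy_def by (intro sum_mono2) auto

definition cutoff :: "'x set \<Rightarrow> ('x \<Rightarrow> real) \<Rightarrow> bool" where
  "cutoff G e \<longleftrightarrow> finite {x. e x \<noteq> 0} \<and> (\<forall>x. 0 \<le> e x \<and> e x \<le> 1) \<and> (\<forall>x\<in>G. e x = 1)"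

lemma cutoff_convex:
  assumes "cutoff G e" "cutoff G f" "0 \<le> \<theta>" "\<theta> \<le> 1"
  shows "cutoff G (\<lambda>x. (1 - \<theta>) * e x + \<theta> * f x)"
proof -
  have "finite {x. (1 - \<theta>) * e x + \<theta> * f x \<noteq> 0}"
    by (rule finite_subset[of _ "{x. e x \<noteq> 0} \<union> {x. f x \<noteq> 0}"]) (use assms in \<open>auto simp: cutoff_def\<close>)
  moreover have "(1 - \<theta>) * e x + \<theta> * f x \<le> 1" for x
    using assms by (intro convex_bound_le) (auto simp: cutoff_def)
  ultimately show ?thesis using assms by (auto simp: cutoff_def)
qed

lemma cutoff_mono: "cutoff G e \<Longrightarrow> H \<subseteq> G \<Longrightarrow> cutoff H e"
  by (auto simp: cutoff_def)

text \<open>If the infimum of the energy over cutoffs were positive, then mixing an almost minimiser with a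
  bounded-energy cutoff that is constant on the pairs carrying almost all of its energy would lower it.\<close>
lemma small_energy_cutoff:
  fixes a :: "'x \<Rightarrow> 'x \<Rightarrow> real"
  assumes a: "\<And>x y. a x y \<ge> 0"
    and bounded: "\<And>G. finite G \<Longrightarrow> \<exists>f. cutoff G f \<and> (\<forall>P. finite P \<longrightarrow> energy a f P \<le> B)"
    and "finite G" "\<epsilon> > 0"
  shows "\<exists>e. cutoff G e \<and> (\<forall>P. finite P \<longrightarrow> energy a e P \<le> \<epsilon>)"
proof -
  define S where "S = {M. \<exists>e. cutoff G e \<and> (\<forall>P. finite P \<longrightarrow> energy a e P \<le> M)}"
  define m where "m = Inf S"
  have BS: "B \<in> S" using bounded[OF \<open>finite G\<close>] by (auto simp: S_def)
  have S0: "M \<ge> 0" if "M \<in> S" for M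
  proof -
    obtain e where "\<forall>P. finite P \<longrightarrow> energy a e P \<le> M" using \<open>M \<in> S\<close> by (auto simp: S_def)
    then have "energy a e {} \<le> M" by blast
    then show ?thesis by (simp add: energy_def)
  qed
  have bdd: "bdd_below S" using S0 by (auto intro!: bdd_belowI[of _ 0])
  have B0: "B \<ge> 0" using S0[OF BS] .
  have m0: "m \<ge> 0" unfolding m_def using BS S0 by (intro cInf_greatest) auto
  \<comment> \<open>Of the slack, one \<delta> comes from replacing M by m, and two from the energy
    that e has outside \<open>P0\<close>.\<close>
  have step: "m \<le> (1 - \<theta>)\<^sup>2 * m + 2 * \<theta>\<^sup>2 * B + 3 * \<delta>"
    if \<theta>: "0 \<le> \<theta>" "\<theta> \<le> 1" and \<delta>: "\<delta> > 0" for \<theta> \<delta>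
  proof -
    have "\<exists>M\<in>S. M < m + \<delta>"
      using cInf_lessD[of S "m + \<delta>"] BS \<delta> by (auto simp: m_def)
    then obtain M e where M: "M < m + \<delta>" and e: "cutoff G e" and eM: "\<And>P. finite P \<Longrightarrow> energy a e P \<le> M"
      by (auto simp: S_def)
    define s where "s = (SUP P\<in>{P. finite P}. energy a e P)"
    have bdd2: "bdd_above (energy a e ` {P. finite P})"
      using eM by (auto intro!: bdd_aboveI)
    have "\<exists>P\<in>{P. finite P}. s - \<delta> < energy a e P"
      using less_cSUP_iff[of "{P. finite P}" "energy a e" "s - \<delta>"] bdd2 \<delta> by (auto simp: s_def)
    then obtain P0 where P0: "finite P0" "s - \<delta> < energy a e P0" by auto
    have le_s: "energy a e P \<le> s" if "finite P" for P
      unfolding s_def using that bdd2 by (intro cSUP_upper) auto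
    \<comment> \<open>As f is 1 at all endpoints of pairs in \<open>P0\<close>, on \<open>P0\<close>
      the mixture g has the differences of e scaled by 1 - \<theta>. Outside \<open>P0\<close> the
      crude bound (p + q)^2 \<le> 2 p^2 + 2 q^2 suffices.\<close>
    have "finite (G \<union> fst ` P0 \<union> snd ` P0)" using \<open>finite G\<close> P0 by auto
    from bounded[OF this] obtain f where f: "cutoff (G \<union> fst ` P0 \<union> snd ` P0) f"
      and fB: "\<And>P. finite P \<Longrightarrow> energy a f P \<le> B" by auto
    define g where "g x = (1 - \<theta>) * e x + \<theta> * f x" for x
    have g: "cutoff G g"
      unfolding g_def using e f \<theta> by (intro cutoff_convex) (auto intro: cutoff_mono)
    have "energy a g P \<le> (1 - \<theta>)\<^sup>2 * M + 2 * \<theta>\<^sup>2 * B + 2 * \<delta>" if P: "finite P" for P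
    proof -
      have fin: "finite (P \<union> P0)" using P P0 by simp
      have "energy a g P \<le> energy a g (P \<union> P0)"
        using fin by (intro energy_mono a) auto
      also have "\<dots> = energy a g P0 + energy a g (P - P0)"
        unfolding energy_def using P P0 by (subst sum.union_disjoint[symmetric]) (auto simp: Un_commute)
      also have "energy a g P0 = (1 - \<theta>)\<^sup>2 * energy a e P0"
        unfolding energy_def sum_distrib_left
      proof (intro sum.cong refl, clarify)
        fix x y assume "(x, y) \<in> P0"
        then have "f x = 1" "f y = 1" using f by (force simp: cutoff_def)+
        then have "g x - g y = (1 - \<theta>) * (e x - e y)" by (simp add: g_def algebra_simps)
        then show "a x y * (g x - g y)\<^sup>2 = (1 - \<theta>)\<^sup>2 * (a x y * (e x - e y)\<^sup>2)"
          by (simp add: power_mult_distrib)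
      qed
      also have "energy a g (P - P0) \<le> (\<Sum>(x, y)\<in>P - P0. 2 * (a x y * (e x - e y)\<^sup>2) + 2 * \<theta>\<^sup>2 * (a x y * (f x - f y)\<^sup>2))"
        unfolding energy_def
      proof (intro sum_mono, clarify)
        fix x y
        have "(g x - g y)\<^sup>2 = ((1 - \<theta>) * (e x - e y) + \<theta> * (f x - f y))\<^sup>2"
          by (simp add: g_def algebra_simps)
        also have "\<dots> \<le> 2 * ((1 - \<theta>) * (e x - e y))\<^sup>2 + 2 * (\<theta> * (f x - f y))\<^sup>2"
          using sum_squares_bound[of "(1 - \<theta>) * (e x - e y)" "\<theta> * (f x - f y)"]
          by (simp add: power2_sum)
        also have "\<dots> = 2 * ((1 - \<theta>)\<^sup>2 * (e x - e y)\<^sup>2) + 2 * \<theta>\<^sup>2 * (f x - f y)\<^sup>2"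
          by (simp add: power_mult_distrib)
        also have "(1 - \<theta>)\<^sup>2 * (e x - e y)\<^sup>2 \<le> 1 * (e x - e y)\<^sup>2"
          using \<theta> by (intro mult_right_mono) (auto simp: power_le_one)
        finally have "(g x - g y)\<^sup>2 \<le> 2 * (e x - e y)\<^sup>2 + 2 * \<theta>\<^sup>2 * (f x - f y)\<^sup>2"
          by simp
        then have "a x y * (g x - g y)\<^sup>2 \<le> a x y * (2 * (e x - e y)\<^sup>2 + 2 * \<theta>\<^sup>2 * (f x - f y)\<^sup>2)"
          by (intro mult_left_mono a)
        then show "a x y * (g x - g y)\<^sup>2 \<le> 2 * (a x y * (e x - e y)\<^sup>2) + 2 * \<theta>\<^sup>2 * (a x y * (f x - f y)\<^sup>2)"
          by (simp add: algebra_simps)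
      qed
      also have "\<dots> = 2 * energy a e (P - P0) + 2 * \<theta>\<^sup>2 * energy a f (P - P0)"
        by (simp add: energy_def sum.distrib sum_distrib_left case_prod_unfold)
      also have "energy a e (P - P0) \<le> \<delta>"
      proof -
        have "energy a e P0 + energy a e (P - P0) = energy a e (P \<union> P0)"
          unfolding energy_def using P P0 by (subst sum.union_disjoint[symmetric]) (auto simp: Un_commute)
        then show ?thesis using le_s[OF fin] P0(2) by simp
      qed
      also have "energy a f (P - P0) \<le> B" using fB P by simp
      also have "energy a e P0 \<le> M" using eM P0 by simp
      finally show ?thesis using \<theta> by (simp add: mult_left_mono)
    qed
    then have "(1 - \<theta>)\<^sup>2 * M + 2 * \<theta>\<^sup>2 * B + 2 * \<delta> \<in> S"
      using g by (auto simp: S_def)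
    then have "m \<le> (1 - \<theta>)\<^sup>2 * M + 2 * \<theta>\<^sup>2 * B + 2 * \<delta>"
      unfolding m_def using bdd by (rule cInf_lower)
    also have "(1 - \<theta>)\<^sup>2 * M \<le> (1 - \<theta>)\<^sup>2 * (m + \<delta>)"
      using M by (intro mult_left_mono) auto
    also have "\<dots> \<le> (1 - \<theta>)\<^sup>2 * m + \<delta>"
      using \<theta> \<delta> mult_right_mono[of "(1 - \<theta>)\<^sup>2" 1 \<delta>] by (simp add: algebra_simps power_le_one)
    finally show ?thesis by simp
  qed
  have "m = 0"
  proof (rule ccontr)
    assume "m \<noteq> 0"
    then have mp: "m > 0" using m0 by simp
    \<comment> \<open>The minimiser of (1 - \<theta>)^2 m + 2 \<theta>^2 B; its value m - \<theta> m
      is below m.\<close>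
    define \<theta> where "\<theta> = m / (m + 2 * B)"
    have \<theta>: "0 < \<theta>" "\<theta> \<le> 1" "\<theta> * (m + 2 * B) = m" using mp B0 by (auto simp: \<theta>_def)
    have "m \<le> (1 - \<theta>)\<^sup>2 * m + 2 * \<theta>\<^sup>2 * B"
    proof (rule field_le_epsilon)
      fix \<delta> :: real assume "\<delta> > 0"
      then show "m \<le> (1 - \<theta>)\<^sup>2 * m + 2 * \<theta>\<^sup>2 * B + \<delta>"
        using step[of \<theta> "\<delta> / 3"] \<theta> by simp
    qed
    also have "\<dots> = m - 2 * \<theta> * m + \<theta> * (\<theta> * (m + 2 * B))"
      by (simp add: power2_eq_square algebra_simps)
    also have "\<dots> = m - \<theta> * m" unfolding \<theta>(3) by simp
    finally show False using mult_pos_pos[OF \<theta>(1) mp] by simp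
  qed
  then have "\<exists>M\<in>S. M < \<epsilon>"
    using cInf_lessD[of S \<epsilon>] BS \<open>\<epsilon> > 0\<close> by (auto simp: m_def)
  then show ?thesis by (force simp: S_def)
qed

section \<open>Lattice point counting and Lipschitz cutoffs\<close>

text \<open>A ball lies in a cube, whose side has 2 * 2^k + 1 \<le> 4 * 2^k points. Dyadic radii
  suit the induction over shells below.\<close>

lemma finite_lnorm_le: "finite {x :: int ^ 'd. lnorm x \<le> r}"
  and card_lnorm_le: "card {x :: int ^ 'd. lnorm x \<le> 2 ^ k} \<le> (4 * 2 ^ k) ^ CARD('d)"
proof -
  define box where "box M = {x :: int ^ 'd. \<forall>i. x $ i \<in> {-M..M}}" for M :: int
  have inj: "inj_on vec_nth X" for X :: "(int ^ 'd) set"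
    by (auto simp: inj_on_def vec_nth_inject)
  have sub: "vec_nth ` box M \<subseteq> PiE UNIV (\<lambda>_. {-M..M})" for M
    by (auto simp: box_def)
  have fin: "finite (box M)" for M
    using sub[of M] by (rule inj_on_finite[OF inj]) (auto intro: finite_PiE)
  have lb: "{x :: int ^ 'd. lnorm x \<le> r} \<subseteq> box M" if "r \<le> real_of_int M" for r M
  proof clarify
    fix x :: "int ^ 'd" assume "lnorm x \<le> r"
    then have "\<bar>real_of_int (x $ i)\<bar> \<le> real_of_int M" for i
      using component_le_lnorm[of x i] that by linarith
    then have "\<bar>x $ i\<bar> \<le> M" for i by (metis of_int_abs of_int_le_iff)
    then show "x \<in> box M" by (auto simp: box_def abs_le_iff minus_le_iff)
  qed
  show "finite {x :: int ^ 'd. lnorm x \<le> r}"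
    using finite_subset[OF lb[of r "\<lceil>r\<rceil>"] fin] by simp
  have "card {x :: int ^ 'd. lnorm x \<le> 2 ^ k} \<le> card (box (2 ^ k))"
    using lb[of "2 ^ k" "2 ^ k"] fin by (intro card_mono) auto
  also have "\<dots> = card (vec_nth ` box (2 ^ k))"
    by (rule card_image[OF inj, symmetric])
  also have "\<dots> \<le> card (PiE (UNIV :: 'd set) (\<lambda>_. {-(2 ^ k)..2 ^ k :: int}))"
    by (intro card_mono sub finite_PiE) auto
  also have "\<dots> = (nat (2 ^ k + 1 + 2 ^ k)) ^ CARD('d)"
    by (subst card_PiE) auto
  also have "\<dots> \<le> (4 * 2 ^ k) ^ CARD('d)"
  proof (rule power_mono)
    have "(2 ^ k + 1 + 2 ^ k :: int) \<le> 4 * 2 ^ k"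
      using one_le_power[of "2 :: int" k] by linarith
    then show "nat (2 ^ k + 1 + 2 ^ k) \<le> 4 * 2 ^ k" by (simp add: nat_le_iff)
  qed simp
  finally show "card {x :: int ^ 'd. lnorm x \<le> 2 ^ k} \<le> (4 * 2 ^ k) ^ CARD('d)" .
qed

text \<open>A dyadic shell has at most 8^d (2^k)^d points of weight at most (2^k)^(2\<sigma> - d),
  as the exponent is negative. The shell sums are bounded by a geometric sequence of ratio q =
  2^(2\<sigma>) > 1, so the last one dominates.\<close>

lemma sum_weight_le:
  assumes "0 < \<sigma>" "2 * \<sigma> < real CARD('d)"
  obtains A where "A > 0" "\<And>k. (\<Sum>x | lnorm (x :: int ^ 'd) \<le> 2 ^ k. max 1 (lnorm x) powr (2 * \<sigma> - real CARD('d)))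
    \<le> A * (2 ^ k) powr (2 * \<sigma>)"
proof
  define d where "d = CARD('d)"
  define q where "q = 2 powr (2 * \<sigma>)"
  have q: "q > 1" unfolding q_def using powr_less_mono[of 0 "2 * \<sigma>" 2] assms by simp
  \<comment> \<open>The first summand gives A + 8^d \<le> A q, which closes the induction; the
    second covers the unit ball.\<close>
  define A where "A = 8 ^ d / (q - 1) + 8 ^ d"
  show "A > 0" using q by (simp add: A_def add_pos_pos)
  have Aq: "A + 8 ^ d \<le> A * q"
  proof -
    have "A * (q - 1) \<ge> 8 ^ d" using q by (simp add: A_def distrib_right)
    then show ?thesis by (simp add: algebra_simps)
  qed
  fix k
  show "(\<Sum>x | lnorm (x :: int ^ 'd) \<le> 2 ^ k. max 1 (lnorm x) powr (2 * \<sigma> - real CARD('d))) \<le> A * (2 ^ k) powr (2 * \<sigma>)"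
    unfolding d_def[symmetric]
  proof (induction k)
    case 0
    have "(\<Sum>x | lnorm (x :: int ^ 'd) \<le> 1. max 1 (lnorm x) powr (2 * \<sigma> - d)) = (\<Sum>x | lnorm (x :: int ^ 'd) \<le> 1. 1)"
      by (intro sum.cong) (auto simp: max_absorb1)
    also have "\<dots> = real (card {x :: int ^ 'd. lnorm x \<le> 1})"
      by simp
    also have "\<dots> \<le> 4 ^ d"
      using of_nat_mono[OF card_lnorm_le[of 0, where 'd = 'd], where 'a = real] by (simp add: d_def)
    also have "\<dots> \<le> 8 ^ d" by (intro power_mono) auto
    also have "\<dots> \<le> A" using q by (simp add: A_def)
    finally show ?case by simp
  next
    case (Suc k)
    let ?N = "\<lambda>k. {x :: int ^ 'd. lnorm x \<le> 2 ^ k}"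
    let ?w = "\<lambda>x :: int ^ 'd. max 1 (lnorm x) powr (2 * \<sigma> - d)"
    have pw: "(2 ^ Suc k) powr (2 * \<sigma>) = q * (2 ^ k) powr (2 * \<sigma>)"
      by (simp add: q_def powr_mult)
    have sub: "?N k \<subseteq> ?N (Suc k)" by (auto intro: order_trans)
    have "(\<Sum>x\<in>?N (Suc k) - ?N k. ?w x) \<le> (\<Sum>x\<in>?N (Suc k) - ?N k. (2 ^ k) powr (2 * \<sigma> - d))"
    proof (intro sum_mono powr_mono2')
      fix x assume "x \<in> ?N (Suc k) - ?N k"
      then show "2 ^ k \<le> max 1 (lnorm x)" by auto
    qed (use assms in \<open>auto simp: d_def\<close>)
    also have "\<dots> = real (card (?N (Suc k) - ?N k)) * (2 ^ k) powr (2 * \<sigma> - d)"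
      by simp
    also have "\<dots> \<le> (8 ^ d * (2 ^ k) ^ d) * (2 ^ k) powr (2 * \<sigma> - d)"
    proof (intro mult_right_mono)
      have "card (?N (Suc k) - ?N k) \<le> card (?N (Suc k))"
        by (intro card_mono finite_lnorm_le) auto
      also have "\<dots> \<le> (4 * 2 ^ Suc k) ^ d" unfolding d_def by (rule card_lnorm_le)
      also have "\<dots> = (8 * 2 ^ k) ^ d" by simp
      also have "\<dots> = 8 ^ d * (2 ^ k) ^ d" by (rule power_mult_distrib)
      finally show "real (card (?N (Suc k) - ?N k)) \<le> 8 ^ d * (2 ^ k) ^ d"
        by (auto dest: of_nat_mono[where 'a = real])
    qed simp
    also have "\<dots> = 8 ^ d * (2 ^ k) powr (2 * \<sigma>)"
      by (simp add: powr_diff powr_realpow)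
    finally have shell: "(\<Sum>x\<in>?N (Suc k) - ?N k. ?w x) \<le> 8 ^ d * (2 ^ k) powr (2 * \<sigma>)" .
    have "(\<Sum>x\<in>?N (Suc k). ?w x) = (\<Sum>x\<in>?N (Suc k) - ?N k. ?w x) + (\<Sum>x\<in>?N k. ?w x)"
      using sub finite_lnorm_le by (intro sum.subset_diff) auto
    also have "\<dots> \<le> 8 ^ d * (2 ^ k) powr (2 * \<sigma>) + (\<Sum>x\<in>?N k. ?w x)"
      using shell by simp
    also have "\<dots> \<le> (A + 8 ^ d) * (2 ^ k) powr (2 * \<sigma>)"
      using Suc by (simp add: algebra_simps)
    also have "\<dots> \<le> (A * q) * (2 ^ k) powr (2 * \<sigma>)"
      using Aq by (intro mult_right_mono) auto
    finally show ?case unfolding pw by (simp add: mult_ac)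
  qed
qed

text \<open>The decay rate of u is critical: the squared weights in the ball of radius 2R sum to
  O(R^(2\<sigma>)), the truncated kernel has mass O(R^(-2\<sigma>)), and the powers of R cancel.
  Hence one B serves for every G.\<close>

lemma bounded_energy_cutoff:
  fixes u :: "int ^ 'd \<Rightarrow> real"
  assumes \<sigma>: "0 < \<sigma>" "\<sigma> < 1" "2 * \<sigma> < real CARD('d)"
    and u: "\<And>x. \<bar>u x\<bar> \<le> C * max 1 (lnorm x) powr (\<sigma> - real CARD('d) / 2)"
  shows "\<exists>B. \<forall>G. finite G \<longrightarrow> (\<exists>f. cutoff G f \<and>
    (\<forall>P. finite P \<longrightarrow> energy (\<lambda>x y. kappa \<sigma> (x - y) * \<bar>u x\<bar> * \<bar>u y\<bar>) f P \<le> B))"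
proof -
  obtain A where A: "A > 0" "\<And>k. (\<Sum>x | lnorm (x :: int ^ 'd) \<le> 2 ^ k. max 1 (lnorm x) powr (2 * \<sigma> - real CARD('d)))
    \<le> A * (2 ^ k) powr (2 * \<sigma>)"
    using sum_weight_le[OF \<sigma>(1,3)] by blast
  obtain K where K: "K > 0" "\<And>R (F :: (int ^ 'd) set). R > 0 \<Longrightarrow> finite F \<Longrightarrow>
    (\<Sum>z\<in>F. min 1 ((lnorm z)\<^sup>2 / R\<^sup>2) * kappa \<sigma> z) \<le> K * R powr (- 2 * \<sigma>)"
    using sum_truncated_kappa_le[OF \<sigma>(1,2)] by blast
  define w where "w x = max 1 (lnorm x) powr (\<sigma> - real CARD('d) / 2)" for x :: "int ^ 'd"
  have w0: "w x \<ge> 0" for x by (simp add: w_def)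
  have w2: "(w x)\<^sup>2 = max 1 (lnorm x) powr (2 * \<sigma> - real CARD('d))" for x
  proof -
    have "(w x)\<^sup>2 = max 1 (lnorm x) powr (\<sigma> - real CARD('d) / 2) * max 1 (lnorm x) powr (\<sigma> - real CARD('d) / 2)"
      by (simp add: w_def power2_eq_square)
    also have "\<dots> = max 1 (lnorm x) powr (2 * \<sigma> - real CARD('d))"
    proof -
      have "\<sigma> - real CARD('d) / 2 + (\<sigma> - real CARD('d) / 2) = 2 * \<sigma> - real CARD('d)" by simp
      then show ?thesis by (simp only: powr_add[symmetric])
    qed
    finally show ?thesis .
  qed
  have wmono: "w y \<le> w x" if "lnorm x \<le> lnorm y" for x y
    unfolding w_def using that \<sigma> by (intro powr_mono2') auto
  \<comment> \<open>The 2 comes from the symmetric terms \<open>v x\<close> and \<open>v y\<close>,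
    the power of 2 from the radius 2R.\<close>
  define B where "B = 2 * C\<^sup>2 * (A * 2 powr (2 * \<sigma>) * K)"
  show ?thesis
  proof (intro exI[of _ B] allI impI)
    fix G :: "(int ^ 'd) set" assume "finite G"
    then obtain b where b: "\<And>x. x \<in> G \<Longrightarrow> lnorm x \<le> b"
      using bdd_above_finite[of "lnorm ` G"] by (auto simp: bdd_above_def)
    obtain k :: nat where k: "b < 2 ^ k" using real_arch_pow[of 2 b] by auto
    define R :: real where "R = 2 ^ k"
    have R: "R > 0" by (simp add: R_def)
    \<comment> \<open>Equal to 1 up to norm R and to 0 from norm 2R on, with Lipschitz constant 1/R;
      hence its squared differences match the truncation in
      \<open>sum_truncated_kappa_le\<close>.\<close>
    define f where "f x = max 0 (min 1 (2 - lnorm x / R))" for x :: "int ^ 'd"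
    have supp: "f x = 0" if "lnorm x > 2 * R" for x
      using that R by (auto simp: f_def max_def min_def field_simps)
    have one: "f x = 1" if "lnorm x \<le> R" for x
      using that R by (auto simp: f_def max_def min_def field_simps)
    have "cutoff G f" unfolding cutoff_def
    proof (intro conjI ballI allI)
      show "finite {x. f x \<noteq> 0}"
        by (rule finite_subset[OF _ finite_lnorm_le[of "2 * R"]]) (use supp in \<open>force simp: not_le\<close>)
      show "f x = 1" if "x \<in> G" for x
        using b[OF that] k by (intro one) (auto simp: R_def)
    qed (auto simp: f_def)
    define \<mu> where "\<mu> z = min 1 ((lnorm z)\<^sup>2 / R\<^sup>2) * kappa \<sigma> z" for z :: "int ^ 'd"
    have \<mu>0: "\<mu> z \<ge> 0" for z by (simp add: \<mu>_def kappa_nonneg)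
    have \<mu>c: "\<mu> (x - y) = \<mu> (y - x)" for x y
      by (simp add: \<mu>_def kappa_commute[of \<sigma> x y] lnorm_minus_commute[of x y])
    have fdiff: "(f x - f y)\<^sup>2 \<le> min 1 ((lnorm (x - y))\<^sup>2 / R\<^sup>2)" for x y
    proof -
      have "\<bar>f x - f y\<bar> \<le> 1" by (auto simp: f_def max_def min_def)
      then have 1: "(f x - f y)\<^sup>2 \<le> 1" by (simp add: abs_square_le_1)
      have "\<bar>f x - f y\<bar> \<le> \<bar>lnorm x / R - lnorm y / R\<bar>"
        by (auto simp: f_def max_def min_def)
      also have "\<dots> = \<bar>lnorm x - lnorm y\<bar> / R" using R by (simp flip: diff_divide_distrib)
      also have "\<dots> \<le> lnorm (x - y) / R" using R lnorm_diff_triangle[of x y] by (intro divide_right_mono) auto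
      finally have "\<bar>f x - f y\<bar>\<^sup>2 \<le> (lnorm (x - y) / R)\<^sup>2" by (intro power_mono) auto
      with 1 show ?thesis by (simp add: power_divide)
    qed
    define v where "v x = (if lnorm x \<le> 2 * R then (w x)\<^sup>2 else 0)" for x :: "int ^ 'd"
    have v0: "v x \<ge> 0" for x by (simp add: v_def)
    have uw: "\<bar>u x\<bar> * \<bar>u y\<bar> \<le> C\<^sup>2 * (w x * w y)" for x y
    proof -
      have "\<bar>u x\<bar> * \<bar>u y\<bar> \<le> (C * w x) * (C * w y)"
        using u[of x] u[of y] by (intro mult_mono) (auto simp: w_def intro: order_trans[OF abs_ge_zero])
      then show ?thesis by (simp add: power2_eq_square mult_ac)
    qed
    text \<open>Since the weight decreases with the norm, a product of two weights is at most the
      square of the one nearer to the origin.\<close>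
    have pt: "w x * w y * (f x - f y)\<^sup>2 \<le> (v x + v y) * min 1 ((lnorm (x - y))\<^sup>2 / R\<^sup>2)" for x y
    proof (cases "lnorm x \<le> 2 * R \<or> lnorm y \<le> 2 * R")
      case False
      then have "f x = 0" "f y = 0" using supp by auto
      then show ?thesis using v0 by simp
    next
      case True
      have "w x * w y \<le> v x + v y"
      proof (cases "lnorm x \<le> lnorm y")
        case le: True
        have "w x * w y \<le> w x * w x" using wmono[OF le] w0 by (intro mult_left_mono)
        also have "\<dots> = v x" using True le by (auto simp: v_def power2_eq_square)
        finally show ?thesis using v0[of y] by simp
      next
        case gt: False
        have "w x * w y \<le> w y * w y" using wmono[of y x] gt w0 by (intro mult_right_mono) auto
        also have "\<dots> = v y" using True gt by (auto simp: v_def power2_eq_square)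
        finally show ?thesis using v0[of x] by simp
      qed
      then show ?thesis using fdiff v0 by (intro mult_mono) auto
    qed
    have "energy (\<lambda>x y. kappa \<sigma> (x - y) * \<bar>u x\<bar> * \<bar>u y\<bar>) f P \<le> B" if P: "finite P" for P
    proof -
      \<comment> \<open>Enlarging P to a square of points makes the double sum symmetric.\<close>
      define Z where "Z = fst ` P \<union> snd ` P"
      have Z: "finite Z" "P \<subseteq> Z \<times> Z" using P by (force simp: Z_def)+
      have mass: "(\<Sum>y\<in>Z. \<mu> (x - y)) \<le> K * R powr (- 2 * \<sigma>)" for x
      proof -
        have "(\<Sum>y\<in>Z. \<mu> (x - y)) = (\<Sum>z\<in>(\<lambda>y. x - y) ` Z. \<mu> z)"
          by (subst sum.reindex) (auto simp: inj_on_def)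
        also have "\<dots> \<le> K * R powr (- 2 * \<sigma>)"
          unfolding \<mu>_def using K(2)[OF R] Z by blast
        finally show ?thesis .
      qed
      have "(\<Sum>x\<in>Z. v x) = (\<Sum>x\<in>{x\<in>Z. lnorm x \<le> 2 * R}. (w x)\<^sup>2)"
        using Z by (simp add: v_def sum.If_cases Int_def)
      also have "\<dots> \<le> (\<Sum>x | lnorm x \<le> 2 * R. (w x)\<^sup>2)"
        by (intro sum_mono2 finite_lnorm_le) auto
      also have "\<dots> \<le> A * (2 ^ Suc k) powr (2 * \<sigma>)"
        using A(2)[of "Suc k"] by (simp add: w2 R_def)
      also have "(2 ^ Suc k) powr (2 * \<sigma>) = 2 powr (2 * \<sigma>) * R powr (2 * \<sigma>)"
        by (simp add: R_def powr_mult)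
      finally have vs: "(\<Sum>x\<in>Z. v x) \<le> A * (2 powr (2 * \<sigma>) * R powr (2 * \<sigma>))" .
      have vm: "(\<Sum>x\<in>Z. \<Sum>y\<in>Z. v x * \<mu> (x - y)) \<le> A * 2 powr (2 * \<sigma>) * K"
      proof -
        have "(\<Sum>x\<in>Z. \<Sum>y\<in>Z. v x * \<mu> (x - y)) \<le> (\<Sum>x\<in>Z. v x * (K * R powr (- 2 * \<sigma>)))"
          unfolding sum_distrib_left[symmetric] by (intro sum_mono mult_left_mono mass v0)
        also have "\<dots> = (\<Sum>x\<in>Z. v x) * (K * R powr (- 2 * \<sigma>))"
          by (simp add: sum_distrib_right)
        also have "\<dots> \<le> A * (2 powr (2 * \<sigma>) * R powr (2 * \<sigma>)) * (K * R powr (- 2 * \<sigma>))"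
          using vs K(1) by (intro mult_right_mono) auto
        also have "\<dots> = A * 2 powr (2 * \<sigma>) * K"
          using R by (simp add: powr_minus field_simps)
        finally show ?thesis .
      qed
      have "energy (\<lambda>x y. kappa \<sigma> (x - y) * \<bar>u x\<bar> * \<bar>u y\<bar>) f P
          \<le> energy (\<lambda>x y. kappa \<sigma> (x - y) * \<bar>u x\<bar> * \<bar>u y\<bar>) f (Z \<times> Z)"
        using Z by (intro energy_mono) (auto simp: kappa_nonneg)
      also have "\<dots> = (\<Sum>x\<in>Z. \<Sum>y\<in>Z. kappa \<sigma> (x - y) * \<bar>u x\<bar> * \<bar>u y\<bar> * (f x - f y)\<^sup>2)"
        unfolding energy_def by (simp add: sum.cartesian_product)
      also have "\<dots> \<le> (\<Sum>x\<in>Z. \<Sum>y\<in>Z. C\<^sup>2 * (v x * \<mu> (x - y) + v y * \<mu> (y - x)))"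
      proof (intro sum_mono)
        fix x y
        have "kappa \<sigma> (x - y) * \<bar>u x\<bar> * \<bar>u y\<bar> * (f x - f y)\<^sup>2
            \<le> (kappa \<sigma> (x - y) * (f x - f y)\<^sup>2) * (C\<^sup>2 * (w x * w y))"
          using mult_left_mono[OF uw[of x y], of "kappa \<sigma> (x - y) * (f x - f y)\<^sup>2"]
          by (simp add: kappa_nonneg mult_ac)
        also have "\<dots> = (C\<^sup>2 * kappa \<sigma> (x - y)) * (w x * w y * (f x - f y)\<^sup>2)"
          by (simp add: mult_ac)
        also have "\<dots> \<le> (C\<^sup>2 * kappa \<sigma> (x - y)) * ((v x + v y) * min 1 ((lnorm (x - y))\<^sup>2 / R\<^sup>2))"
          by (intro mult_left_mono pt) (simp add: kappa_nonneg)
        also have "\<dots> = C\<^sup>2 * (v x * \<mu> (x - y) + v y * \<mu> (x - y))"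
          by (simp add: \<mu>_def algebra_simps)
        finally show "kappa \<sigma> (x - y) * \<bar>u x\<bar> * \<bar>u y\<bar> * (f x - f y)\<^sup>2 \<le> C\<^sup>2 * (v x * \<mu> (x - y) + v y * \<mu> (y - x))"
          by (simp only: \<mu>c[of y x])
      qed
      also have "\<dots> = C\<^sup>2 * ((\<Sum>x\<in>Z. \<Sum>y\<in>Z. v x * \<mu> (x - y)) + (\<Sum>x\<in>Z. \<Sum>y\<in>Z. v y * \<mu> (y - x)))"
        by (simp only: sum_distrib_left[symmetric] sum.distrib)
      also have "(\<Sum>x\<in>Z. \<Sum>y\<in>Z. v y * \<mu> (y - x)) = (\<Sum>x\<in>Z. \<Sum>y\<in>Z. v x * \<mu> (x - y))"
        by (rule sum.swap)
      also have "C\<^sup>2 * ((\<Sum>x\<in>Z. \<Sum>y\<in>Z. v x * \<mu> (x - y)) + (\<Sum>x\<in>Z. \<Sum>y\<in>Z. v x * \<mu> (x - y)))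
          = 2 * C\<^sup>2 * (\<Sum>x\<in>Z. \<Sum>y\<in>Z. v x * \<mu> (x - y))"
        by (simp only: mult_2[symmetric] mult_ac)
      also have "\<dots> \<le> B"
        unfolding B_def by (intro mult_left_mono vm) simp
      finally show ?thesis .
    qed
    with \<open>cutoff G f\<close> show "\<exists>f. cutoff G f \<and>
      (\<forall>P. finite P \<longrightarrow> energy (\<lambda>x y. kappa \<sigma> (x - y) * \<bar>u x\<bar> * \<bar>u y\<bar>) f P \<le> B)" by blast
  qed
qed

subsection \<open>Harmonic functions of constant sign\<close>

text \<open>Nonzero lattice points have norm at least 1, so truncation at R = 1 does not change the
  kernel.\<close>

lemma kappa_summable:
  assumes "0 < \<sigma>" "\<sigma> < 1"
  shows "kappa \<sigma> summable_on (UNIV :: (int ^ 'd) set)"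
proof -
  obtain K where K: "K > 0" "\<And>R (F :: (int ^ 'd) set). R > 0 \<Longrightarrow> finite F \<Longrightarrow>
    (\<Sum>z\<in>F. min 1 ((lnorm z)\<^sup>2 / R\<^sup>2) * kappa \<sigma> z) \<le> K * R powr (- 2 * \<sigma>)"
    using sum_truncated_kappa_le[OF assms] by blast
  have "sum (kappa \<sigma>) F \<le> K" if "finite F" for F :: "(int ^ 'd) set"
  proof -
    have "min 1 ((lnorm z)\<^sup>2) * kappa \<sigma> z = kappa \<sigma> z" for z :: "int ^ 'd"
      using lnorm_ge_1[of z] by (cases "z = 0") (auto simp: kappa_0 min_def)
    then have "sum (kappa \<sigma>) F = (\<Sum>z\<in>F. min 1 ((lnorm z)\<^sup>2 / 1\<^sup>2) * kappa \<sigma> z)"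
      by (simp only: one_power2 div_by_1)
    then show ?thesis using K(2)[of 1 F] that by simp
  qed
  then show ?thesis
    by (intro nonneg_bdd_above_summable_on) (auto simp: kappa_nonneg intro!: bdd_aboveI[of _ K])
qed

lemma kappa_diff_summable:
  fixes x :: "int ^ 'd"
  assumes "0 < \<sigma>" "\<sigma> < 1"
  shows "(\<lambda>y. kappa \<sigma> (x - y)) summable_on UNIV"
    and "(\<Sum>\<^sub>\<infinity>y. kappa \<sigma> (x - y)) = infsum (kappa \<sigma>) (UNIV :: (int ^ 'd) set)"
proof -
  have bij: "bij_betw (\<lambda>y. x - y) UNIV (UNIV :: (int ^ 'd) set)"
    by (rule bij_betw_byWitness[of _ "\<lambda>y. x - y"]) auto
  show "(\<lambda>y. kappa \<sigma> (x - y)) summable_on UNIV"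
    using summable_on_reindex_bij_betw[OF bij, of "kappa \<sigma>"] kappa_summable[OF assms] by simp
  show "(\<Sum>\<^sub>\<infinity>y. kappa \<sigma> (x - y)) = infsum (kappa \<sigma>) (UNIV :: (int ^ 'd) set)"
    by (rule infsum_reindex_bij_betw[OF bij, of "kappa \<sigma>"])
qed

text \<open>Summability of the kernel allows the defining sum to be split into a diagonal part and a
  convolution.\<close>

lemma frac_lap_eq:
  fixes x :: "int ^ 'd"
  assumes "0 < \<sigma>" "\<sigma> < 1" "(\<lambda>y. kappa \<sigma> (x - y) * f y) summable_on UNIV"
  shows "frac_lap \<sigma> f x = infsum (kappa \<sigma>) (UNIV :: (int ^ 'd) set) * f x - (\<Sum>\<^sub>\<infinity>y. kappa \<sigma> (x - y) * f y)"
proof -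
  have "((\<lambda>y. kappa \<sigma> (x - y) * f x) has_sum infsum (kappa \<sigma>) (UNIV :: (int ^ 'd) set) * f x) UNIV"
    using kappa_diff_summable[OF assms(1,2), of x]
    by (intro has_sum_cmult_left) (simp add: has_sum_infsum flip: kappa_diff_summable(2)[OF assms(1,2), of x])
  moreover have "((\<lambda>y. - (kappa \<sigma> (x - y) * f y)) has_sum - (\<Sum>\<^sub>\<infinity>y. kappa \<sigma> (x - y) * f y)) UNIV"
    using has_sum_infsum[OF assms(3)] by (rule has_sum_uminusI)
  ultimately have "((\<lambda>y. kappa \<sigma> (x - y) * f x + - (kappa \<sigma> (x - y) * f y)) has_sum
      infsum (kappa \<sigma>) (UNIV :: (int ^ 'd) set) * f x + - (\<Sum>\<^sub>\<infinity>y. kappa \<sigma> (x - y) * f y)) UNIV"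
    by (rule has_sum_add)
  then show ?thesis unfolding frac_lap_def by (intro infsumI) (simp add: right_diff_distrib)
qed

lemma frac_dom_summable:
  assumes "frac_dom \<sigma> u"
  shows "(\<lambda>y. kappa \<sigma> (x - y) * u y) summable_on UNIV"
proof -
  have "(\<lambda>y. norm (kappa \<sigma> (x - y) * u y)) summable_on UNIV"
    using assms by (simp add: frac_dom_def abs_mult kappa_nonneg)
  then show ?thesis by (rule abs_summable_summable)
qed

text \<open>Positivity is tested with |u| e, and the equation for u replaces K + V by the
  convolution \<open>T\<close>. Symmetrising e(x)^2 on F \<times> F leaves e(x) e(y) plus half of
  (e(x) - e(y))^2, and only the latter is charged to the energy.\<close>

lemma sign_defect_le_energy:
  fixes u V :: "int ^ 'd \<Rightarrow> real"
  assumes \<sigma>: "0 < \<sigma>" "\<sigma> < 1"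
    and pos: "frac_schr_positive \<sigma> V" and harm: "frac_harmonic \<sigma> V u"
    and F: "finite F" "\<And>x. x \<notin> F \<Longrightarrow> e x = 0"
    and M: "\<And>P. finite P \<Longrightarrow> energy (\<lambda>x y. kappa \<sigma> (x - y) * \<bar>u x\<bar> * \<bar>u y\<bar>) e P \<le> M"
  shows "(\<Sum>x\<in>F. \<Sum>y\<in>F. kappa \<sigma> (x - y) * (\<bar>u x\<bar> * \<bar>u y\<bar> - u x * u y) * (e x * e y)) \<le> M"
proof -
  define K where "K = infsum (kappa \<sigma>) (UNIV :: (int ^ 'd) set)"
  define T where "T x = (\<Sum>\<^sub>\<infinity>y. kappa \<sigma> (x - y) * u y)" for x
  have dom: "frac_dom \<sigma> u" using harm by (simp add: frac_harmonic_def)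
  have Ku: "(K + V x) * u x = T x" for x
  proof -
    have "frac_lap \<sigma> u x + V x * u x = 0" using harm by (simp add: frac_harmonic_def)
    moreover have "frac_lap \<sigma> u x = K * u x - T x"
      unfolding K_def T_def by (rule frac_lap_eq[OF \<sigma> frac_dom_summable[OF dom]])
    ultimately show ?thesis by (simp add: distrib_right)
  qed
  define \<phi> where "\<phi> x = \<bar>u x\<bar> * e x" for x
  have \<phi>F: "{x. \<phi> x \<noteq> 0} \<subseteq> F" using F(2) by (auto simp: \<phi>_def)
  have lap: "frac_lap \<sigma> \<phi> x = K * \<phi> x - (\<Sum>y\<in>F. kappa \<sigma> (x - y) * \<phi> y)" for x
  proof -
    have "((\<lambda>y. kappa \<sigma> (x - y) * \<phi> y) has_sum (\<Sum>y\<in>F. kappa \<sigma> (x - y) * \<phi> y)) F"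
      using F(1) by simp
    moreover have "((\<lambda>y. kappa \<sigma> (x - y) * \<phi> y) has_sum (\<Sum>y\<in>F. kappa \<sigma> (x - y) * \<phi> y)) F
        \<longleftrightarrow> ((\<lambda>y. kappa \<sigma> (x - y) * \<phi> y) has_sum (\<Sum>y\<in>F. kappa \<sigma> (x - y) * \<phi> y)) UNIV"
      by (rule has_sum_cong_neutral) (use \<phi>F in auto)
    ultimately have hs: "((\<lambda>y. kappa \<sigma> (x - y) * \<phi> y) has_sum (\<Sum>y\<in>F. kappa \<sigma> (x - y) * \<phi> y)) UNIV"
      by blast
    show ?thesis
      using frac_lap_eq[OF \<sigma>, of x \<phi>] hs by (auto simp: K_def summable_on_def infsumI)
  qed
  let ?D = "\<lambda>g. (\<Sum>x\<in>F. \<Sum>y\<in>F. kappa \<sigma> (x - y) * g x y * (e x * e y))"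
  have "0 \<le> (\<Sum>x\<in>{x. \<phi> x \<noteq> 0}. frac_lap \<sigma> \<phi> x * \<phi> x) + (\<Sum>x\<in>{x. \<phi> x \<noteq> 0}. V x * (\<phi> x)\<^sup>2)"
    using pos finite_subset[OF \<phi>F F(1)] by (simp add: frac_schr_positive_def)
  also have "(\<Sum>x\<in>{x. \<phi> x \<noteq> 0}. frac_lap \<sigma> \<phi> x * \<phi> x) = (\<Sum>x\<in>F. frac_lap \<sigma> \<phi> x * \<phi> x)"
    using \<phi>F F(1) by (intro sum.mono_neutral_left) auto
  also have "(\<Sum>x\<in>{x. \<phi> x \<noteq> 0}. V x * (\<phi> x)\<^sup>2) = (\<Sum>x\<in>F. V x * (\<phi> x)\<^sup>2)"
    using \<phi>F F(1) by (intro sum.mono_neutral_left) auto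
  also have "(\<Sum>x\<in>F. frac_lap \<sigma> \<phi> x * \<phi> x) + (\<Sum>x\<in>F. V x * (\<phi> x)\<^sup>2)
      = (\<Sum>x\<in>F. T x * (u x * (e x)\<^sup>2)) - ?D (\<lambda>x y. \<bar>u x\<bar> * \<bar>u y\<bar>)"
  proof -
    have "frac_lap \<sigma> \<phi> x * \<phi> x + V x * (\<phi> x)\<^sup>2
        = T x * (u x * (e x)\<^sup>2) - (\<Sum>y\<in>F. kappa \<sigma> (x - y) * (\<bar>u x\<bar> * \<bar>u y\<bar>) * (e x * e y))" for x
    proof -
      have "frac_lap \<sigma> \<phi> x * \<phi> x + V x * (\<phi> x)\<^sup>2
          = (K + V x) * (\<phi> x)\<^sup>2 - (\<Sum>y\<in>F. kappa \<sigma> (x - y) * \<phi> y) * \<phi> x"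
        by (simp add: lap power2_eq_square algebra_simps)
      also have "(K + V x) * (\<phi> x)\<^sup>2 = ((K + V x) * u x) * (u x * (e x)\<^sup>2)"
        by (simp add: \<phi>_def power_mult_distrib) (simp add: power2_eq_square)
      also have "\<dots> = T x * (u x * (e x)\<^sup>2)" by (simp only: Ku)
      also have "(\<Sum>y\<in>F. kappa \<sigma> (x - y) * \<phi> y) * \<phi> x
          = (\<Sum>y\<in>F. kappa \<sigma> (x - y) * (\<bar>u x\<bar> * \<bar>u y\<bar>) * (e x * e y))"
        unfolding sum_distrib_right by (intro sum.cong refl) (simp add: \<phi>_def mult_ac)
      finally show ?thesis .
    qed
    then show ?thesis by (simp only: sum.distrib[symmetric] sum_subtractf[symmetric])
  qed
  finally have 1: "?D (\<lambda>x y. \<bar>u x\<bar> * \<bar>u y\<bar>) \<le> (\<Sum>x\<in>F. T x * (u x * (e x)\<^sup>2))" by simp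
  \<comment> \<open>The convolution is approximated by sums over finite sets Y containing F, so that
    only finite sums are rearranged.\<close>
  have 2: "(\<Sum>x\<in>F. T x * (u x * (e x)\<^sup>2)) \<le> M + ?D (\<lambda>x y. u x * u y)"
  proof (rule tendsto_upperbound)
    show "((\<lambda>Y. \<Sum>x\<in>F. (\<Sum>y\<in>Y. kappa \<sigma> (x - y) * u y) * (u x * (e x)\<^sup>2))
        \<longlongrightarrow> (\<Sum>x\<in>F. T x * (u x * (e x)\<^sup>2))) (finite_subsets_at_top UNIV)"
    proof (intro tendsto_sum tendsto_mult tendsto_const)
      fix x
      show "((\<lambda>Y. \<Sum>y\<in>Y. kappa \<sigma> (x - y) * u y) \<longlongrightarrow> T x) (finite_subsets_at_top UNIV)"
        using has_sum_infsum[OF frac_dom_summable[OF dom, of x]] by (simp add: has_sum_def T_def)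
    qed
    show "\<forall>\<^sub>F Y in finite_subsets_at_top UNIV.
      (\<Sum>x\<in>F. (\<Sum>y\<in>Y. kappa \<sigma> (x - y) * u y) * (u x * (e x)\<^sup>2)) \<le> M + ?D (\<lambda>x y. u x * u y)"
      unfolding eventually_finite_subsets_at_top
    proof (intro exI[of _ F] conjI allI impI F(1) subset_UNIV)
      fix Y :: "(int ^ 'd) set" assume "finite Y \<and> F \<subseteq> Y \<and> Y \<subseteq> UNIV"
      then have Y: "finite Y" "F \<subseteq> Y" by auto
      define a where "a x y = kappa \<sigma> (x - y) * \<bar>u x\<bar> * \<bar>u y\<bar>" for x y
      define b where "b x y = kappa \<sigma> (x - y) * (u x * u y)" for x y
      have ba: "b x y * r \<le> a x y * r" if "r \<ge> 0" for x y r
        unfolding a_def b_def using that abs_ge_self[of "u x * u y"]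
        by (intro mult_right_mono) (auto simp: abs_mult mult.assoc kappa_nonneg intro!: mult_left_mono)
      have a0: "a x y \<ge> 0" for x y by (simp add: a_def kappa_nonneg)
      have bc: "b x y = b y x" for x y by (simp add: b_def kappa_commute[of \<sigma> x y] mult.commute)
      have "(\<Sum>x\<in>F. (\<Sum>y\<in>Y. kappa \<sigma> (x - y) * u y) * (u x * (e x)\<^sup>2)) = (\<Sum>x\<in>F. \<Sum>y\<in>Y. b x y * (e x)\<^sup>2)"
        unfolding sum_distrib_right by (intro sum.cong refl) (simp add: b_def mult_ac)
      also have "\<dots> = (\<Sum>x\<in>F. \<Sum>y\<in>Y-F. b x y * (e x)\<^sup>2) + (\<Sum>x\<in>F. \<Sum>y\<in>F. b x y * (e x)\<^sup>2)"
        using Y F by (simp add: sum.subset_diff[of F Y] sum.distrib)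
      also have "(\<Sum>x\<in>F. \<Sum>y\<in>F. b x y * (e x)\<^sup>2)
          = (\<Sum>x\<in>F. \<Sum>y\<in>F. b x y * ((e x - e y)\<^sup>2 / 2)) + ?D (\<lambda>x y. u x * u y)"
      proof -
        have "(\<Sum>x\<in>F. \<Sum>y\<in>F. b x y * (e y)\<^sup>2) = (\<Sum>x\<in>F. \<Sum>y\<in>F. b x y * (e x)\<^sup>2)"
          by (subst sum.swap) (simp add: bc)
        moreover have "(\<Sum>x\<in>F. \<Sum>y\<in>F. b x y * ((e x - e y)\<^sup>2 / 2)) + ?D (\<lambda>x y. u x * u y)
            = (\<Sum>x\<in>F. \<Sum>y\<in>F. b x y * (e x)\<^sup>2 / 2 + b x y * (e y)\<^sup>2 / 2)"
          unfolding b_def sum.distrib[symmetric]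
          by (intro sum.cong refl) (simp add: power2_eq_square field_simps)
        ultimately show ?thesis
          by (simp add: sum.distrib flip: sum_divide_distrib)
      qed
      \<comment> \<open>The factor 1/2 is given away so that this block and the one over Y - F add
        up to the energy of F \<times> Y.\<close>
      also have "(\<Sum>x\<in>F. \<Sum>y\<in>F. b x y * ((e x - e y)\<^sup>2 / 2)) \<le> (\<Sum>x\<in>F. \<Sum>y\<in>F. a x y * (e x - e y)\<^sup>2)"
      proof (intro sum_mono)
        fix x y
        have "b x y * ((e x - e y)\<^sup>2 / 2) \<le> a x y * ((e x - e y)\<^sup>2 / 2)" by (intro ba) simp
        also have "\<dots> \<le> a x y * (e x - e y)\<^sup>2" by (intro mult_left_mono a0) simp
        finally show "b x y * ((e x - e y)\<^sup>2 / 2) \<le> a x y * (e x - e y)\<^sup>2" .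
      qed
      \<comment> \<open>Outside F the cutoff vanishes, so e(x)^2 is already (e(x) - e(y))^2.\<close>
      also have "(\<Sum>x\<in>F. \<Sum>y\<in>Y-F. b x y * (e x)\<^sup>2) \<le> (\<Sum>x\<in>F. \<Sum>y\<in>Y-F. a x y * (e x - e y)\<^sup>2)"
        using F(2) by (intro sum_mono) (auto intro: ba)
      finally have "(\<Sum>x\<in>F. (\<Sum>y\<in>Y. kappa \<sigma> (x - y) * u y) * (u x * (e x)\<^sup>2))
          \<le> ((\<Sum>x\<in>F. \<Sum>y\<in>Y-F. a x y * (e x - e y)\<^sup>2) + (\<Sum>x\<in>F. \<Sum>y\<in>F. a x y * (e x - e y)\<^sup>2))
            + ?D (\<lambda>x y. u x * u y)" by simp
      also have "(\<Sum>x\<in>F. \<Sum>y\<in>Y-F. a x y * (e x - e y)\<^sup>2) + (\<Sum>x\<in>F. \<Sum>y\<in>F. a x y * (e x - e y)\<^sup>2)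
          = (\<Sum>x\<in>F. \<Sum>y\<in>Y. a x y * (e x - e y)\<^sup>2)"
        using Y F by (simp add: sum.subset_diff[of F Y] sum.distrib)
      also have "\<dots> = energy a e (F \<times> Y)"
        by (simp add: energy_def sum.cartesian_product)
      also have "\<dots> \<le> M"
        using M[of "F \<times> Y"] Y F unfolding a_def by simp
      finally show "(\<Sum>x\<in>F. (\<Sum>y\<in>Y. kappa \<sigma> (x - y) * u y) * (u x * (e x)\<^sup>2)) \<le> M + ?D (\<lambda>x y. u x * u y)"
        by simp
    qed
  qed simp
  have "?D (\<lambda>x y. \<bar>u x\<bar> * \<bar>u y\<bar> - u x * u y) = ?D (\<lambda>x y. \<bar>u x\<bar> * \<bar>u y\<bar>) - ?D (\<lambda>x y. u x * u y)"
    by (simp only: sum_subtractf[symmetric] left_diff_distrib right_diff_distrib)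
  with 1 2 show ?thesis by simp
qed

section \<open>From decay at infinity to the vanishing of u\<close>

text \<open>The asymptotic bound fails only in a finite ball, where the constant can be enlarged.
  The maximum with 1 is there because the bare power has the value 0 at the origin.\<close>

lemma bigo_lat_infty_imp_bound:
  fixes u :: "int ^ 'd \<Rightarrow> real"
  assumes "u \<in> O[lat_infty](\<lambda>x. lnorm x powr p)"
  shows "\<exists>C. \<forall>x. \<bar>u x\<bar> \<le> C * max 1 (lnorm x) powr p"
proof -
  obtain c where "c > 0" "\<forall>\<^sub>F x in lat_infty. norm (u x) \<le> c * norm (lnorm x powr p)"
    using assms by (elim landau_o.bigE) auto
  then obtain N where N: "\<And>x. N \<le> lnorm x \<Longrightarrow> \<bar>u x\<bar> \<le> c * lnorm x powr p"
    by (auto simp: lat_infty_def eventually_filtercomap eventually_at_top_linorder)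
  define S where "S = {x :: int ^ 'd. lnorm x \<le> max 1 N}"
  define C where "C = c + (\<Sum>x\<in>S. \<bar>u x\<bar> / max 1 (lnorm x) powr p)"
  have S: "finite S" unfolding S_def by (rule finite_lnorm_le)
  have "\<bar>u x\<bar> \<le> C * max 1 (lnorm x) powr p" for x
  proof (cases "x \<in> S")
    case True
    have "\<bar>u x\<bar> / max 1 (lnorm x) powr p \<le> (\<Sum>x\<in>S. \<bar>u x\<bar> / max 1 (lnorm x) powr p)"
      using True S by (intro member_le_sum) auto
    also have "\<dots> \<le> C" using \<open>c > 0\<close> by (simp add: C_def)
    finally show ?thesis by (simp add: divide_le_eq)
  next
    case False
    then have "\<bar>u x\<bar> \<le> c * max 1 (lnorm x) powr p" using N[of x] by (simp add: S_def)
    also have "\<dots> \<le> C * max 1 (lnorm x) powr p"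
      by (intro mult_right_mono) (auto simp: C_def intro!: sum_nonneg)
    finally show ?thesis .
  qed
  then show ?thesis by blast
qed

theorem theorem4p1:
  fixes \<sigma> :: real and V u :: "int ^ 'd \<Rightarrow> real"
  assumes "0 < \<sigma>" and "\<sigma> < min 1 (real CARD('d) / 2)"
    and "\<forall>x. V x \<le> 1"
    and "frac_schr_positive \<sigma> V"
    and "frac_harmonic \<sigma> V u"
    and "u \<in> O[lat_infty](\<lambda>x. lnorm x powr (\<sigma> - real CARD('d) / 2))"
    and "Liminf lat_infty (\<lambda>x. ereal (\<bar>u x\<bar> * lnorm x powr (real CARD('d) + 2 * \<sigma>))) = 0"
  shows "u = (\<lambda>x. 0)"
proof (rule ccontr)
  assume "u \<noteq> (\<lambda>x. 0)"
  then obtain y0 where y0: "u y0 \<noteq> 0" by auto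
  have \<sigma>: "0 < \<sigma>" "\<sigma> < 1" "2 * \<sigma> < real CARD('d)" using assms(1,2) by auto
  define p where "p = real CARD('d) + 2 * \<sigma>"
  have p: "p > 0" using \<sigma> by (simp add: p_def add_nonneg_pos)
  obtain c where c: "c > 0" "\<And>x :: int ^ 'd. x \<noteq> 0 \<Longrightarrow> c * lnorm x powr (- p) \<le> kappa \<sigma> x"
    using kappa_ge[OF \<sigma>(1,2), where 'd = 'd] unfolding p_def by blast
  have kpos: "kappa \<sigma> x > 0" if "x \<noteq> 0" for x :: "int ^ 'd"
  proof -
    have "0 < c * lnorm x powr (- p)" using c(1) lnorm_ge_1[OF that] by simp
    then show ?thesis using c(2)[OF that] by linarith
  qed
  obtain C where C: "\<And>x. \<bar>u x\<bar> \<le> C * max 1 (lnorm x) powr (\<sigma> - real CARD('d) / 2)"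
    using bigo_lat_infty_imp_bound[OF assms(6)] by blast
  define a where "a x y = kappa \<sigma> (x - y) * \<bar>u x\<bar> * \<bar>u y\<bar>" for x y
  have a0: "a x y \<ge> 0" for x y by (simp add: a_def kappa_nonneg)
  obtain B where B: "\<And>G. finite G \<Longrightarrow> \<exists>f. cutoff G f \<and> (\<forall>P. finite P \<longrightarrow> energy a f P \<le> B)"
    using bounded_energy_cutoff[OF \<sigma> C] unfolding a_def by blast
  \<comment> \<open>For a cutoff equal to 1 at x and y, the defect of this pair is one term of a sum
    of nonnegative terms that is at most \<epsilon>. As the kernel is positive off the diagonal, the
    defect itself vanishes.\<close>
  have same_sign: "\<bar>u x\<bar> * \<bar>u y\<bar> = u x * u y" for x y
  proof (cases "x = y")
    case False
    let ?g = "\<lambda>x y. kappa \<sigma> (x - y) * (\<bar>u x\<bar> * \<bar>u y\<bar> - u x * u y)"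
    have g0: "?g x y \<ge> 0" for x y
      using abs_ge_self[of "u x * u y"] by (simp add: kappa_nonneg abs_mult)
    have "?g x y \<le> 0 + \<epsilon>" if \<epsilon>: "\<epsilon> > 0" for \<epsilon>
    proof -
      obtain e where e: "cutoff {x, y} e" and eP: "\<And>P. finite P \<Longrightarrow> energy a e P \<le> \<epsilon>"
        using small_energy_cutoff[OF a0 B, of "{x, y}" \<epsilon>] \<epsilon> by auto
      define F where "F = {x. e x \<noteq> 0}"
      have F: "finite F" "x \<in> F" "y \<in> F" using e by (auto simp: F_def cutoff_def)
      have g1: "?g x' y' * (e x' * e y') \<ge> 0" for x' y'
        using e by (intro mult_nonneg_nonneg g0) (auto simp: cutoff_def)
      have "?g x y = ?g x y * (e x * e y)" using e by (simp add: cutoff_def)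
      also have "\<dots> \<le> (\<Sum>y\<in>F. ?g x y * (e x * e y))"
        using F g1 by (intro member_le_sum) auto
      also have "\<dots> \<le> (\<Sum>x\<in>F. \<Sum>y\<in>F. ?g x y * (e x * e y))"
        using F by (intro member_le_sum[where f = "\<lambda>x. \<Sum>y\<in>F. ?g x y * (e x * e y)"] sum_nonneg g1) auto
      also have "\<dots> \<le> \<epsilon>"
        using eP F(1) by (intro sign_defect_le_energy[OF \<sigma>(1,2) assms(4,5)]) (auto simp: F_def a_def[abs_def])
      finally show ?thesis by simp
    qed
    then have "?g x y \<le> 0" by (rule field_le_epsilon)
    with g0[of x y] have "?g x y = 0" by simp
    then show ?thesis using kpos[of "x - y"] False by auto
  qed (simp flip: abs_mult)
  define s where "s = sgn (u y0)"
  have s: "s * u y0 = \<bar>u y0\<bar>" "\<bar>s\<bar> = 1" using y0 by (auto simp: s_def sgn_if)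
  have su: "s * u x = \<bar>u x\<bar>" for x
  proof -
    have "\<bar>u y0\<bar> * (s * u x) = \<bar>u y0\<bar> * \<bar>u x\<bar>"
      using same_sign[of y0 x] by (simp add: s_def abs_mult_sgn flip: mult.assoc)
    then show ?thesis using y0 by simp
  qed
  define K where "K = infsum (kappa \<sigma>) (UNIV :: (int ^ 'd) set)"
  have K0: "K \<ge> 0" unfolding K_def by (intro infsum_nonneg kappa_nonneg)
  have dom: "frac_dom \<sigma> u" using assms(5) by (simp add: frac_harmonic_def)
  \<comment> \<open>After multiplication by the common sign s, all terms of the convolution are
    nonnegative, and only the one at \<open>y0\<close> is kept.\<close>
  have lower: "kappa \<sigma> (x - y0) * \<bar>u y0\<bar> \<le> (K + 1) * \<bar>u x\<bar>" for x
  proof -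
    have "((\<lambda>y. kappa \<sigma> (x - y) * u y) has_sum (K + V x) * u x) UNIV"
    proof -
      have "frac_lap \<sigma> u x + V x * u x = 0" using assms(5) by (simp add: frac_harmonic_def)
      moreover have "frac_lap \<sigma> u x = K * u x - (\<Sum>\<^sub>\<infinity>y. kappa \<sigma> (x - y) * u y)"
        unfolding K_def by (rule frac_lap_eq[OF \<sigma>(1,2) frac_dom_summable[OF dom]])
      ultimately have "(K + V x) * u x = (\<Sum>\<^sub>\<infinity>y. kappa \<sigma> (x - y) * u y)" by (simp add: distrib_right)
      then show ?thesis using has_sum_infsum[OF frac_dom_summable[OF dom, of x]] by simp
    qed
    then have "((\<lambda>y. s * (kappa \<sigma> (x - y) * u y)) has_sum s * ((K + V x) * u x)) UNIV"
      by (rule has_sum_cmult_right)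
    then have hs: "((\<lambda>y. kappa \<sigma> (x - y) * \<bar>u y\<bar>) has_sum (K + V x) * \<bar>u x\<bar>) UNIV"
      by (simp only: mult.left_commute[of s] su)
    have "(\<Sum>y\<in>{y0}. kappa \<sigma> (x - y) * \<bar>u y\<bar>) \<le> (K + V x) * \<bar>u x\<bar>"
      by (rule finite_sum_le_has_sum[OF hs]) (auto simp: kappa_nonneg)
    also have "\<dots> \<le> (K + 1) * \<bar>u x\<bar>"
      using assms(3) by (intro mult_right_mono) auto
    finally show ?thesis by simp
  qed
  \<comment> \<open>The power of 2 pays for |x - y0| \<le> 2 |x|. The condition |x| \<ge> |y0| + 1
    ensures both this and x \<noteq> y0.\<close>
  define \<delta> where "\<delta> = c * 2 powr (- p) * \<bar>u y0\<bar> / (K + 1)"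
  have \<delta>: "\<delta> > 0" using c y0 K0 by (simp add: \<delta>_def)
  have "\<delta> \<le> \<bar>u x\<bar> * lnorm x powr p" if x: "lnorm x \<ge> lnorm y0 + 1" for x
  proof -
    have ne: "x - y0 \<noteq> 0" using x by auto
    have lx: "lnorm x > 0" using x lnorm_nonneg[of y0] by linarith
    have "lnorm (x - y0) \<le> 2 * lnorm x"
      using lnorm_triangle[of x "- y0"] x by (simp add: lnorm_uminus)
    then have "(2 * lnorm x) powr (- p) \<le> lnorm (x - y0) powr (- p)"
      using p lnorm_ge_1[OF ne] by (intro powr_mono2') auto
    then have "c * (2 * lnorm x) powr (- p) \<le> kappa \<sigma> (x - y0)"
      using c(2)[OF ne] c(1) by (meson mult_left_mono order_trans less_imp_le)
    then have "c * (2 * lnorm x) powr (- p) * \<bar>u y0\<bar> \<le> (K + 1) * \<bar>u x\<bar>"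
      using lower[of x] by (meson mult_right_mono order_trans abs_ge_zero)
    then have "c * (2 * lnorm x) powr (- p) * \<bar>u y0\<bar> * lnorm x powr p \<le> (K + 1) * \<bar>u x\<bar> * lnorm x powr p"
      by (rule mult_right_mono) simp
    moreover have "(2 * lnorm x) powr (- p) * lnorm x powr p = 2 powr (- p)"
      using lx by (simp add: powr_mult powr_minus)
    ultimately have "c * 2 powr (- p) * \<bar>u y0\<bar> \<le> (K + 1) * (\<bar>u x\<bar> * lnorm x powr p)"
      by (simp add: mult_ac)
    then show ?thesis using K0 by (simp add: \<delta>_def divide_le_eq mult_ac)
  qed
  then have "\<forall>\<^sub>F x in lat_infty. ereal \<delta> \<le> ereal (\<bar>u x\<bar> * lnorm x powr p)"
    unfolding lat_infty_def eventually_filtercomap eventually_at_top_linorder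
    by (intro exI[of _ "\<lambda>r. r \<ge> lnorm y0 + 1"]) auto
  then have "ereal \<delta> \<le> Liminf lat_infty (\<lambda>x. ereal (\<bar>u x\<bar> * lnorm x powr p))"
    by (rule Liminf_bounded)
  then show False using assms(7) \<delta> by (simp add: p_def)
qed

end
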